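(* Let $G=(\mathcal{A}\cup\mathcal{B},E)$ be an instance of the stable marriage problem with two-sided ties and two-sided critical vertices, with critical set $\mathcal{C}\subseteq \mathcal{A}\cup\mathcal{B}$. Then $G$ always admits a matching $M$ which is a critical relaxed stable matching, and such a matching can be computed efficiently (in polynomial time). Moreover, the computed $M$ satisfies $|M|\ge \frac{2}{3}|M'|$, where $M'$ is a maximum-size critical relaxed stable matching in $G$.
   Context: The input is a bipartite graph $G=(\mathcal{A}\cup\mathcal{B},E)$, where $E$ is the set of acceptable pairs. Each vertex $u\in\mathcal{A}\cup\mathcal{B}$ ranks its neighbours in $G$ by a preference ordering that may contain ties: each edge $(u,v)$ has a rank from $u$'s point of view, $v_1\succ_u v_2$ means the rank of $(u,v_1)$ is strictly smaller (better) than that of $(u,v_2)$, $v_1=_u v_2$ means equal ranks, and $v_1\succeq_u v_2$ means the rank of $v_1$ is at least as good as that of $v_2$. A subset $\mathcal{C}\subseteq\mathcal{A}\cup\mathcal{B}$ of vertices is designated as critical. A matching $M\subseteq E$ is a set of edges sharing no endpoint; $M(u)$ denotes the partner of $u$ in $M$. A matching $M$ is critical if no matching in $G$ matches more critical vertices than $M$. Given a matching $M$, a pair $(a,b)\in E\setminus M$ with $a\in\mathcal{A}$, $b\in\mathcal{B}$ is a blocking pair w.r.t. $M$ if (i) $a$ is unmatched or $b\succ_a M(a)$, and (ii) $b$ is unmatched or $a\succ_b M(b)$. A matching $M$ is relaxed stable if for every blocking pair $(a,b)$ w.r.t. $M$, either $a$ is matched and $M(a)$ is critical, or $b$ is matched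 and $M(b)$ is critical. A critical relaxed stable matching is a matching that is both critical and relaxed stable. *)

theory Defs
  imports Complex_Main "HOL-Computational_Algebra.Polynomial"
begin

section \<open>Instances and matchings\<close>

text \<open>
  \<open>rank G u v\<close> is the rank of the edge between \<open>u\<close> and \<open>v\<close> from the point of view of \<open>u\<close>;
  smaller is better and equal ranks are ties. It is only relevant for neighbours \<open>v\<close> of \<open>u\<close>.
  Edges are pairs whose first component lies in \<open>side_A G\<close>.
\<close>

record 'v smti =
  side_A :: "'v set"
  side_B :: "'v set"
  edges :: "('v \<times> 'v) set"
  rank :: "'v \<Rightarrow> 'v \<Rightarrow> nat"
  critical_set :: "'v set"

definition valid_instance :: "'v smti \<Rightarrow> bool" where
  "valid_instance G \<longleftrightarrow>
     finite (side_A G) \<and> finite (side_B G) \<and> side_A G \<inter> side_B G = {} \<and>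
     edges G \<subseteq> side_A G \<times> side_B G \<and>
     critical_set G \<subseteq> side_A G \<union> side_B G"

definition prefers :: "'v smti \<Rightarrow> 'v \<Rightarrow> 'v \<Rightarrow> 'v \<Rightarrow> bool" where
  "prefers G u v w \<longleftrightarrow> rank G u v < rank G u w"

definition matching :: "'v smti \<Rightarrow> ('v \<times> 'v) set \<Rightarrow> bool" where
  "matching G M \<longleftrightarrow> M \<subseteq> edges G \<and>
     (\<forall>e\<in>M. \<forall>f\<in>M. e \<noteq> f \<longrightarrow> {fst e, snd e} \<inter> {fst f, snd f} = {})"

definition matched :: "('v \<times> 'v) set \<Rightarrow> 'v \<Rightarrow> bool" where
  "matched M u \<longleftrightarrow> (\<exists>v. (u, v) \<in> M \<or> (v, u) \<in> M)"

definition partner :: "('v \<times> 'v) set \<Rightarrow> 'v \<Rightarrow> 'v" where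
  "partner M u = (THE v. (u, v) \<in> M \<or> (v, u) \<in> M)"

definition critical :: "'v smti \<Rightarrow> ('v \<times> 'v) set \<Rightarrow> bool" where
  "critical G M \<longleftrightarrow>
     (\<forall>N. matching G N \<longrightarrow>
        card {u \<in> critical_set G. matched N u} \<le> card {u \<in> critical_set G. matched M u})"

definition blocking_pair :: "'v smti \<Rightarrow> ('v \<times> 'v) set \<Rightarrow> 'v \<Rightarrow> 'v \<Rightarrow> bool" where
  "blocking_pair G M a b \<longleftrightarrow>
     (a, b) \<in> edges G - M \<and>
     (\<not> matched M a \<or> prefers G a b (partner M a)) \<and>
     (\<not> matched M b \<or> prefers G b a (partner M b))"

definition relaxed_stable :: "'v smti \<Rightarrow> ('v \<times> 'v) set \<Rightarrow> bool" where
  "relaxed_stable G M \<longleftrightarrow>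
     (\<forall>a b. blocking_pair G M a b \<longrightarrow>
        (matched M a \<and> partner M a \<in> critical_set G) \<or>
        (matched M b \<and> partner M b \<in> critical_set G))"

definition critical_relaxed_stable_matching :: "'v smti \<Rightarrow> ('v \<times> 'v) set \<Rightarrow> bool" where
  "critical_relaxed_stable_matching G M \<longleftrightarrow>
     matching G M \<and> critical G M \<and> relaxed_stable G M"

definition max_critical_relaxed_stable_matching :: "'v smti \<Rightarrow> ('v \<times> 'v) set \<Rightarrow> bool" where
  "max_critical_relaxed_stable_matching G M \<longleftrightarrow>
     critical_relaxed_stable_matching G M \<and>
     (\<forall>N. critical_relaxed_stable_matching G N \<longrightarrow> card N \<le> card M)"


section \<open>The model of computation\<close>

text \<open>
  A structured random access machine: while programs over named, unbounded, zero-initialised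
  arrays of natural numbers (a scalar is an array used at index 0 only), with a big-step semantics
  that counts executed commands. Expressions have a size fixed by the program. The only arithmetic
  is addition and truncated subtraction, so one step lengthens the binary representation of the
  largest number in memory by at most a constant; hence a polynomial number of steps of this
  machine is polynomial time on a Turing machine. Multiplication is deliberately not a
  primitive, since at unit cost it would break this.
\<close>

type_synonym vname = string
type_synonym state = "vname \<Rightarrow> nat \<Rightarrow> nat"

datatype aexp = Lit nat | Acc vname aexp | Plus aexp aexp | Minus aexp aexp
datatype bexp = Less aexp aexp | Not bexp | And bexp bexp
datatype com =
    Skip
  | Store vname aexp aexp
  | Seq com com
  | If bexp com com
  | While bexp com

fun aval :: "aexp \<Rightarrow> state \<Rightarrow> nat" where
  "aval (Lit n) s = n"
| "aval (Acc x i) s = s x (aval i s)"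
| "aval (Plus e f) s = aval e s + aval f s"
| "aval (Minus e f) s = aval e s - aval f s"

fun bval :: "bexp \<Rightarrow> state \<Rightarrow> bool" where
  "bval (Less e f) s \<longleftrightarrow> aval e s < aval f s"
| "bval (Not b) s \<longleftrightarrow> \<not> bval b s"
| "bval (And b c) s \<longleftrightarrow> bval b s \<and> bval c s"

text \<open>\<open>exec c s t s'\<close>: started in \<open>s\<close>, the program \<open>c\<close> halts in \<open>s'\<close> after \<open>t\<close> steps.\<close>

inductive exec :: "com \<Rightarrow> state \<Rightarrow> nat \<Rightarrow> state \<Rightarrow> bool" where
  Skip: "exec Skip s 1 s"
| Store: "exec (Store x i e) s 1 (s(x := (s x)(aval i s := aval e s)))"
| Seq: "exec c s t s' \<Longrightarrow> exec d s' u s'' \<Longrightarrow> exec (Seq c d) s (t + u) s''"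
| IfTrue: "bval b s \<Longrightarrow> exec c s t s' \<Longrightarrow> exec (If b c d) s (t + 1) s'"
| IfFalse: "\<not> bval b s \<Longrightarrow> exec d s t s' \<Longrightarrow> exec (If b c d) s (t + 1) s'"
| WhileFalse: "\<not> bval b s \<Longrightarrow> exec (While b c) s 1 s"
| WhileTrue: "bval b s \<Longrightarrow> exec c s t s' \<Longrightarrow> exec (While b c) s' u s'' \<Longrightarrow>
    exec (While b c) s (t + u + 1) s''"

inductive_cases exec_SkipE: "exec Skip s t s'"
inductive_cases exec_StoreE: "exec (Store x i e) s t s'"
inductive_cases exec_SeqE: "exec (Seq c d) s t s'"
inductive_cases exec_IfE: "exec (If b c d) s t s'"
inductive_cases exec_WhileE: "exec (While b c) s t s'"

lemma exec_deterministic: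
  "exec c s t s' \<Longrightarrow> exec c s u s'' \<Longrightarrow> u = t \<and> s'' = s'"
proof (induction arbitrary: u s'' rule: exec.induct)
  case (Skip s)
  from Skip.prems show ?case by (auto elim: exec_SkipE)
next
  case (Store x i e s)
  from Store.prems show ?case by (auto elim: exec_StoreE)
next
  case (Seq c s t s' d u s'' v r)
  from Seq.prems obtain t1 t2 s1 where "exec c s t1 s1" "exec d s1 t2 r" "v = t1 + t2"
    by (auto elim: exec_SeqE)
  with Seq.IH show ?case by metis
next
  case (IfTrue b s c t s' d)
  from IfTrue.prems obtain t1 where "exec c s t1 s''" "u = t1 + 1"
    by (rule exec_IfE) (use IfTrue.hyps in auto)
  with IfTrue.IH show ?case by metis
next
  case (IfFalse b s d t s' c)
  from IfFalse.prems obtain t1 where "exec d s t1 s''" "u = t1 + 1"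
    by (rule exec_IfE) (use IfFalse.hyps in auto)
  with IfFalse.IH show ?case by metis
next
  case (WhileFalse b s c)
  from WhileFalse.prems show ?case
    by (rule exec_WhileE) (use WhileFalse.hyps in auto)
next
  case (WhileTrue b s c t s' u s'' v r)
  from WhileTrue.prems obtain t1 t2 s1
    where "exec c s t1 s1" "exec (While b c) s1 t2 r" "v = t1 + t2 + 1"
    by (rule exec_WhileE) (use WhileTrue.hyps in auto)
  with WhileTrue.IH show ?case by metis
qed


section \<open>Input and output\<close>

text \<open>
  A presentation of \<open>G\<close> numbers the vertices of each side by the positions in the lists \<open>xs\<close> and
  \<open>ys\<close>, and lists every edge exactly once, in any order, as a pair of such positions.
\<close>

definition presents ::
  "'v list \<Rightarrow> 'v list \<Rightarrow> (nat \<times> nat) list \<Rightarrow> 'v smti \<Rightarrow> bool" where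
  "presents xs ys es G \<longleftrightarrow>
     distinct xs \<and> set xs = side_A G \<and>
     distinct ys \<and> set ys = side_B G \<and>
     distinct es \<and> set es \<subseteq> {..<length xs} \<times> {..<length ys} \<and>
     (\<lambda>(i, j). (xs ! i, ys ! j)) ` set es = edges G"

text \<open>
  Input arrays: the numbers of vertices of both sides and of edges; for the \<open>k\<close>-th edge its two
  endpoints and its rank from the point of view of each of them; for each vertex a flag telling
  whether it is critical. All other memory is 0.
\<close>

definition input_state ::
  "'v smti \<Rightarrow> 'v list \<Rightarrow> 'v list \<Rightarrow> (nat \<times> nat) list \<Rightarrow> state" where
  "input_state G xs ys es = (\<lambda>_ _. 0)
     (''num_A'' := (\<lambda>_. 0)(0 := length xs),
      ''num_B'' := (\<lambda>_. 0)(0 := length ys),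
      ''num_E'' := (\<lambda>_. 0)(0 := length es),
      ''end_A'' := (\<lambda>k. if k < length es then fst (es ! k) else 0),
      ''end_B'' := (\<lambda>k. if k < length es then snd (es ! k) else 0),
      ''rank_A'' := (\<lambda>k. if k < length es
         then rank G (xs ! fst (es ! k)) (ys ! snd (es ! k)) else 0),
      ''rank_B'' := (\<lambda>k. if k < length es
         then rank G (ys ! snd (es ! k)) (xs ! fst (es ! k)) else 0),
      ''crit_A'' := (\<lambda>i. if i < length xs \<and> xs ! i \<in> critical_set G then 1 else 0),
      ''crit_B'' := (\<lambda>j. if j < length ys \<and> ys ! j \<in> critical_set G then 1 else 0))"

text \<open>The output is the set of edges whose flag in the array \<open>''out''\<close> is nonzero.\<close>

definition output_edges ::
  "'v list \<Rightarrow> 'v list \<Rightarrow> (nat \<times> nat) list \<Rightarrow> state \<Rightarrow> ('v \<times> 'v) set" where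
  "output_edges xs ys es s =
     {(xs ! fst (es ! k), ys ! snd (es ! k)) | k. k < length es \<and> s ''out'' k \<noteq> 0}"

text \<open>
  \<open>computes_in_time P p G Q\<close>: on every presentation of \<open>G\<close> the program \<open>P\<close> halts within
  \<open>p(|A| + |B| + |E|)\<close> steps, and the edge set it computes satisfies \<open>Q\<close>. The set may depend
  on the presentation, as ties are broken by the order of the input.
\<close>

definition computes_in_time ::
  "com \<Rightarrow> nat poly \<Rightarrow> 'v smti \<Rightarrow> (('v \<times> 'v) set \<Rightarrow> bool) \<Rightarrow> bool" where
  "computes_in_time P p G Q \<longleftrightarrow>
     (\<forall>xs ys es. presents xs ys es G \<longrightarrow>
        (\<exists>t s. exec P (input_state G xs ys es) t s \<and>
               t \<le> poly p (card (side_A G) + card (side_B G) + card (edges G)) \<and>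
               Q (output_edges xs ys es s)))"

end

theory Submission imports Defs begin

text \<open>
  The matching comes from a deferred acceptance procedure in which every edge carries a level. Let
  \<open>t\<close> and \<open>s\<close> be the numbers of vertices of the sides B and A. Edges to critical \<open>b\<close> start at level 0,
  all others at level \<open>t\<close>; a rejection raises the level by one. Edges of noncritical \<open>a\<close> stop at
  level \<open>t + 1\<close>, those of critical \<open>a\<close> at \<open>t + 1 + s\<close>. A free \<open>a\<close> proposes along an edge of least level,
  then best rank, then with free \<open>b\<close>; \<open>b\<close> prefers higher levels, except that \<open>t + 1\<close> beats \<open>t\<close> only in
  a tie. If the partner of \<open>b\<close> has an equally good free alternative, \<open>b\<close> takes the new proposer and
  the partner moves there. Each step raises a level or enlarges the matching, which bounds the
  number of steps.

  Criticality: with \<open>t\<close> low and \<open>s\<close> high levels, the pigeonhole principle yields an unused level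
  whenever a critical vertex is unmatched, and cutting there gives an optimal dual solution.
  Relaxed stability: if neither partner in a would-be blocking pair is critical, only levels \<open>t\<close> and
  \<open>t + 1\<close> are involved, where \<open>b\<close> follows its ranks. Size: relative to a relaxed stable \<open>N\<close> there is
  no augmenting path with one or three edges, the latter because the level \<open>t + 1\<close> proposal and the
  rule on alternatives force the middle edge to block \<open>N\<close>.
\<close>

section \<open>Matchings certified by levels\<close>

lemma matching_unique:
  assumes "matching G M"
  shows "(a, b) \<in> M \<Longrightarrow> (a, b') \<in> M \<Longrightarrow> b = b'"
    and "(a, b) \<in> M \<Longrightarrow> (a', b) \<in> M \<Longrightarrow> a = a'"
  using assms unfolding matching_def by fastforce+

lemma matching_inj_on:
  assumes "matching G M"
  shows "inj_on fst M" and "inj_on snd M"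
  using matching_unique[OF assms] by (auto intro!: inj_onI)

lemma matching_finite:
  assumes "valid_instance G" and "matching G M"
  shows "finite M"
  using assms unfolding valid_instance_def matching_def
  by (meson finite_SigmaI finite_subset)

lemma matched_side:
  assumes "valid_instance G" and "matching G M"
  shows "a \<in> side_A G \<Longrightarrow> matched M a \<longleftrightarrow> (\<exists>b. (a, b) \<in> M)"
    and "b \<in> side_B G \<Longrightarrow> matched M b \<longleftrightarrow> (\<exists>a. (a, b) \<in> M)"
  using assms unfolding matched_def valid_instance_def matching_def by blast+

lemma partner_eq:
  assumes "valid_instance G" and "matching G M" and "(a, b) \<in> M"
  shows "partner M a = b" and "partner M b = a"
proof -
  have ab: "M \<subseteq> side_A G \<times> side_B G" "side_A G \<inter> side_B G = {}"
    using assms unfolding valid_instance_def matching_def by blast+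
  show "partner M a = b"
    unfolding partner_def
    by (rule the_equality) (use ab assms(3) matching_unique[OF assms(2)] in blast)+
  show "partner M b = a"
    unfolding partner_def
    by (rule the_equality) (use ab assms(3) matching_unique[OF assms(2)] in blast)+
qed

text \<open>The sides are disjoint and each vertex lies on at most one edge of \<open>M\<close>, so
  no critical vertex is counted twice. An edge thus weighs as much as it has critical ends, which
  turns criticality into maximum weight.\<close>

lemma card_critical_matched:
  assumes "valid_instance G" and "matching G M"
  shows "card {u \<in> critical_set G. matched M u} =
    (\<Sum>e\<in>M. of_bool (fst e \<in> critical_set G) + of_bool (snd e \<in> critical_set G))"
proof -
  let ?C = "critical_set G"
  have fin: "finite M" using matching_finite[OF assms] .
  have "{u \<in> ?C. matched M u} = (fst ` M \<inter> ?C) \<union> (snd ` M \<inter> ?C)"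
    unfolding matched_def by force
  moreover have "(fst ` M \<inter> ?C) \<inter> (snd ` M \<inter> ?C) = {}"
    using assms unfolding valid_instance_def matching_def by fastforce
  ultimately have "card {u \<in> ?C. matched M u} = card (fst ` M \<inter> ?C) + card (snd ` M \<inter> ?C)"
    using fin by (simp add: card_Un_disjoint)
  also have "card (fst ` M \<inter> ?C) = (\<Sum>e\<in>M. of_bool (fst e \<in> ?C))"
    using fin sum.reindex[OF matching_inj_on(1)[OF assms(2)], of "\<lambda>x. of_bool (x \<in> ?C) :: nat"]
    by (simp add: sum_of_bool_eq Int_def)
  also have "card (snd ` M \<inter> ?C) = (\<Sum>e\<in>M. of_bool (snd e \<in> ?C))"
    using fin sum.reindex[OF matching_inj_on(2)[OF assms(2)], of "\<lambda>x. of_bool (x \<in> ?C) :: nat"]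
    by (simp add: sum_of_bool_eq Int_def)
  finally show ?thesis by (simp add: sum.distrib)
qed

text \<open>
  Matching as many critical vertices as possible is a maximum weight matching problem, and \<open>y\<^sub>A\<close>, \<open>y\<^sub>B\<close> is a dual solution satisfying complementary slackness.
\<close>

lemma critical_by_duality:
  fixes y\<^sub>A y\<^sub>B :: "'v \<Rightarrow> nat"
  assumes "valid_instance G" and "matching G M"
    and feasible: "\<And>a b. (a, b) \<in> edges G \<Longrightarrow>
      of_bool (a \<in> critical_set G) + of_bool (b \<in> critical_set G) \<le> y\<^sub>A a + y\<^sub>B b"
    and tight: "\<And>a b. (a, b) \<in> M \<Longrightarrow>
      y\<^sub>A a + y\<^sub>B b \<le> of_bool (a \<in> critical_set G) + of_bool (b \<in> critical_set G)"
    and slack_A: "\<And>a. a \<in> side_A G \<Longrightarrow> \<not> matched M a \<Longrightarrow> y\<^sub>A a = 0"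
    and slack_B: "\<And>b. b \<in> side_B G \<Longrightarrow> \<not> matched M b \<Longrightarrow> y\<^sub>B b = 0"
  shows "critical G M"
  unfolding critical_def
proof (intro allI impI)
  fix N assume N: "matching G N"
  let ?C = "critical_set G"
  have fin: "finite (side_A G)" "finite (side_B G)"
    and sub: "edges G \<subseteq> side_A G \<times> side_B G"
    using assms(1) unfolding valid_instance_def by auto
  have split: "(\<Sum>e\<in>K. y\<^sub>A (fst e) + y\<^sub>B (snd e)) = sum y\<^sub>A (fst ` K) + sum y\<^sub>B (snd ` K)"
    if "matching G K" for K
    using matching_inj_on[OF that] by (simp add: sum.distrib sum.reindex)
  have ends: "fst ` K \<subseteq> side_A G" "snd ` K \<subseteq> side_B G" if "matching G K" for K
    using that sub unfolding matching_def by force+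
  have "card {u \<in> ?C. matched N u} \<le> (\<Sum>e\<in>N. y\<^sub>A (fst e) + y\<^sub>B (snd e))"
    unfolding card_critical_matched[OF assms(1) N]
    by (rule sum_mono) (use N feasible in \<open>force simp: matching_def\<close>)
  also have "\<dots> \<le> sum y\<^sub>A (side_A G) + sum y\<^sub>B (side_B G)"
    unfolding split[OF N] using ends[OF N] fin by (intro add_mono sum_mono2) auto
  \<comment> \<open>Complementary slackness: unmatched vertices have dual value 0, so the sum over
    the whole side shrinks to the vertices covered by \<open>M\<close>.\<close>
  also have "sum y\<^sub>A (side_A G) = sum y\<^sub>A (fst ` M)"
    by (rule sum.mono_neutral_right)
      (use ends[OF assms(2)] fin slack_A matched_side(1)[OF assms(1,2)] in \<open>force+\<close>)
  also have "sum y\<^sub>B (side_B G) = sum y\<^sub>B (snd ` M)"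
    by (rule sum.mono_neutral_right)
      (use ends[OF assms(2)] fin slack_B matched_side(2)[OF assms(1,2)] in \<open>force+\<close>)
  also have "sum y\<^sub>A (fst ` M) + sum y\<^sub>B (snd ` M) = (\<Sum>e\<in>M. y\<^sub>A (fst e) + y\<^sub>B (snd e))"
    using split[OF assms(2)] by simp
  also have "\<dots> \<le> card {u \<in> ?C. matched M u}"
    unfolding card_critical_matched[OF assms(1,2)]
    by (rule sum_mono) (use tight in force)
  finally show "card {u \<in> ?C. matched N u} \<le> card {u \<in> ?C. matched M u}" .
qed

text \<open>Pigeonhole principle: the image of \<open>S\<close> is too small to cover
  \<open>L\<close>. It is applied to the levels occurring on matching edges.\<close>

lemma unused_level:
  fixes f :: "'e \<Rightarrow> nat"
  assumes "finite S" and "card S < card L"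
  obtains j where "j \<in> L" and "j \<notin> f ` S"
  using assms by (metis card_image_le card_mono finite_imageI leD le_trans subsetI)

section \<open>Levels, offers, and what a finished run guarantees\<close>

text \<open>
  Level \<open>t + 1\<close> gives a rejected proposer a second chance at level \<open>t\<close>: it only breaks ties, so both
  levels form one class. A proposal of a higher class beats every proposal of a lower one.
\<close>

definition level_class :: "nat \<Rightarrow> nat \<Rightarrow> nat" where
  "level_class t c = (if c \<le> t then c else c - 1)"

text \<open>A total preorder of offers, lexicographic in class, rank and level, with the better
  offer second. It is weak because a partner is kept when a new offer is only equally good.\<close>

definition offer_le :: "nat \<Rightarrow> nat \<Rightarrow> nat \<Rightarrow> nat \<Rightarrow> nat \<Rightarrow> bool" where
  "offer_le t c r c' r' \<longleftrightarrow> level_class t c < level_class t c' \<or>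
     level_class t c = level_class t c' \<and> (r' < r \<or> r' = r \<and> c \<le> c')"

lemma offer_le_class: "offer_le t c r c' r' \<Longrightarrow> level_class t c \<le> level_class t c'"
  unfolding offer_le_def by auto

text \<open>The extra levels granted by critical vertices, below \<open>card (side_B G)\<close> here
  and above \<open>card (side_B G) + 1\<close> in \<open>last_level\<close>, are as many as a side
  has vertices: a matching that misses a vertex of that side cannot occupy them all.\<close>

definition first_level :: "'v smti \<Rightarrow> 'v \<Rightarrow> nat" where
  "first_level G b = (if b \<in> critical_set G then 0 else card (side_B G))"

definition last_level :: "'v smti \<Rightarrow> 'v \<Rightarrow> nat" where
  "last_level G a = card (side_B G) + 1 + (if a \<in> critical_set G then card (side_A G) else 0)"

text \<open>
  \<open>lev a b\<close> counts how often \<open>b\<close> has turned \<open>a\<close> down, starting from \<open>first_level G b\<close>. The assumption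
  \<open>unsettled\<close> holds because any rival would have taken over \<open>b\<close> while \<open>a\<close> moved to the free
  \<open>b\<^sub>0\<close> at no loss.
\<close>

locale proposal_outcome =
  fixes G :: "'v smti" and M :: "('v \<times> 'v) set" and lev :: "'v \<Rightarrow> 'v \<Rightarrow> nat"
  assumes valid: "valid_instance G"
    and matching: "matching G M"
    and lev_first: "(a, b) \<in> edges G \<Longrightarrow> first_level G b \<le> lev a b"
    and lev_last: "(a, b) \<in> M \<Longrightarrow> lev a b \<le> last_level G a"
    and best: "(a, b) \<in> M \<Longrightarrow> (a, b') \<in> edges G \<Longrightarrow>
      lev a b < lev a b' \<or> lev a b = lev a b' \<and> rank G a b \<le> rank G a b'"
    and rejected: "(a, b) \<in> edges G \<Longrightarrow> first_level G b < lev a b \<Longrightarrow>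
      \<exists>a'. (a', b) \<in> M \<and>
        offer_le (card (side_B G)) (lev a b - 1) (rank G b a) (lev a' b) (rank G b a')"
    and exhausted: "(a, b) \<in> edges G \<Longrightarrow> \<not> matched M a \<Longrightarrow> last_level G a < lev a b"
    and unsettled: "(a, b) \<in> M \<Longrightarrow> (a, b\<^sub>0) \<in> edges G \<Longrightarrow> \<not> matched M b\<^sub>0 \<Longrightarrow>
      lev a b\<^sub>0 = lev a b \<Longrightarrow> rank G a b\<^sub>0 = rank G a b \<Longrightarrow> (a', b) \<in> edges G \<Longrightarrow>
      lev a' b = first_level G b"
begin

lemma M_edges: "(a, b) \<in> M \<Longrightarrow> (a, b) \<in> edges G"
  using matching unfolding matching_def by blast

lemma edge_sides: "(a, b) \<in> edges G \<Longrightarrow> a \<in> side_A G \<and> b \<in> side_B G"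
  using valid unfolding valid_instance_def by blast

lemma finite_sides: "finite (side_A G)" "finite (side_B G)"
  using valid unfolding valid_instance_def by blast+

lemmas matched_A = matched_side(1)[OF valid matching]
lemmas matched_B = matched_side(2)[OF valid matching]
lemmas M_unique = matching_unique[OF matching]
lemmas partner_M = partner_eq[OF valid matching]

lemma critical_B_if_low: "(a, b) \<in> edges G \<Longrightarrow> lev a b < card (side_B G) \<Longrightarrow> b \<in> critical_set G"
  using lev_first[of a b] by (auto simp: first_level_def split: if_splits)

lemma critical_A_if_high: "(a, b) \<in> M \<Longrightarrow> card (side_B G) + 1 < lev a b \<Longrightarrow> a \<in> critical_set G"
  using lev_last[of a b] by (auto simp: last_level_def split: if_splits)

text \<open>
  If some critical vertex of side B is unmatched, then fewer than \<open>card (side_B G)\<close> edges are matched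
  and some level \<open>j\<close> below \<open>card (side_B G)\<close> is unused. Neighbours of vertices served below \<open>j\<close> are at
  level at most \<open>j\<close>, hence matched below \<open>j\<close>. \<open>high_zone\<close> is the mirror image.
\<close>

lemma low_zone:
  obtains S\<^sub>A S\<^sub>B where
    "\<And>a b. (a, b) \<in> M \<Longrightarrow> a \<in> S\<^sub>A \<longleftrightarrow> b \<in> S\<^sub>B"
    "\<And>a b. (a, b) \<in> edges G \<Longrightarrow> b \<in> S\<^sub>B \<Longrightarrow> a \<in> S\<^sub>A"
    "\<And>a b. (a, b) \<in> M \<Longrightarrow> a \<in> S\<^sub>A \<Longrightarrow> lev a b < card (side_B G)"
    "\<And>a. a \<in> S\<^sub>A \<Longrightarrow> \<exists>b. (a, b) \<in> M"
    "S\<^sub>B \<subseteq> critical_set G"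
    "\<And>b. b \<in> side_B G \<Longrightarrow> b \<in> critical_set G \<Longrightarrow> \<not> matched M b \<Longrightarrow> b \<in> S\<^sub>B"
proof (cases "\<forall>b\<in>side_B G. b \<in> critical_set G \<longrightarrow> matched M b")
  case True
  show ?thesis by (rule that[of "{}" "{}"]) (use True in auto)
next
  case False
  then obtain b\<^sub>0 where b0: "b\<^sub>0 \<in> side_B G" "\<not> matched M b\<^sub>0" by blast
  let ?t = "card (side_B G)"
  have fin: "finite M" using matching_finite[OF valid matching] .
  have "card M = card (snd ` M)"
    using matching_inj_on(2)[OF matching] by (simp add: card_image)
  also have "\<dots> < ?t"
    by (rule psubset_card_mono)
      (use finite_sides b0 M_edges edge_sides in \<open>force simp: matched_def\<close>)+
  finally have "card M < card {..<?t}" by simp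
  then obtain j where "j \<in> {..<?t}" and unused: "j \<notin> (\<lambda>e. lev (fst e) (snd e)) ` M"
    by (rule unused_level[OF fin])
  then have j: "j < ?t" by simp
  define S\<^sub>A where "S\<^sub>A = {a. \<exists>b. (a, b) \<in> M \<and> lev a b < j}"
  \<comment> \<open>An unmatched critical \<open>b\<close> satisfies the universal condition
    vacuously, so it belongs to the zone.\<close>
  define S\<^sub>B where "S\<^sub>B = {b \<in> critical_set G. \<forall>a. (a, b) \<in> M \<longrightarrow> lev a b < j}"
  show ?thesis
  proof (rule that[of S\<^sub>A S\<^sub>B])
    fix a b assume e: "(a, b) \<in> edges G" and b: "b \<in> S\<^sub>B"
    \<comment> \<open>Otherwise \<open>b\<close> has rejected \<open>a\<close> at level
      \<open>j\<close> or above, which requires a partner of class at least \<open>j\<close>; but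
      \<open>b\<close> can only be served below \<open>j\<close>.\<close>
    have "lev a b \<le> j"
    proof (rule ccontr)
      assume "\<not> lev a b \<le> j"
      moreover from this b have "first_level G b < lev a b"
        by (auto simp: first_level_def S\<^sub>B_def)
      then obtain a' where "(a', b) \<in> M"
        "offer_le ?t (lev a b - 1) (rank G b a) (lev a' b) (rank G b a')"
        using rejected[OF e] by blast
      moreover from this(1) b have "lev a' b < j" by (auto simp: S\<^sub>B_def)
      ultimately show False
        using j by (auto simp: level_class_def split: if_splits dest!: offer_le_class)
    qed
    then have "lev a b \<le> last_level G a" using j by (simp add: last_level_def)
    then have "matched M a" using exhausted[OF e] by linarith
    then obtain b' where b': "(a, b') \<in> M" using matched_A edge_sides[OF e] by blast
    moreover have "lev a b' \<le> j" using best[OF b' e] \<open>lev a b \<le> j\<close> by linarith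
    moreover have "lev a b' \<noteq> j" using unused b' by force
    ultimately show "a \<in> S\<^sub>A" unfolding S\<^sub>A_def by fastforce
  next
    fix a b assume ab: "(a, b) \<in> M"
    show "a \<in> S\<^sub>A \<longleftrightarrow> b \<in> S\<^sub>B"
      using ab M_unique critical_B_if_low[OF M_edges[OF ab]] j
      unfolding S\<^sub>A_def S\<^sub>B_def by (auto dest: M_unique)
  qed (use j M_unique edge_sides in \<open>auto simp: S\<^sub>A_def S\<^sub>B_def matched_def dest: M_unique\<close>)
qed

lemma high_zone:
  obtains T\<^sub>A T\<^sub>B where
    "\<And>a b. (a, b) \<in> edges G \<Longrightarrow> a \<in> T\<^sub>A \<Longrightarrow> b \<in> T\<^sub>B"
    "\<And>a b. (a, b) \<in> M \<Longrightarrow> a \<in> T\<^sub>A \<longleftrightarrow> b \<in> T\<^sub>B"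
    "\<And>a b. (a, b) \<in> M \<Longrightarrow> a \<in> T\<^sub>A \<Longrightarrow> card (side_B G) + 1 < lev a b"
    "\<And>b. b \<in> T\<^sub>B \<Longrightarrow> \<exists>a. (a, b) \<in> M"
    "T\<^sub>A \<subseteq> critical_set G"
    "\<And>a. a \<in> side_A G \<Longrightarrow> a \<in> critical_set G \<Longrightarrow> \<not> matched M a \<Longrightarrow> a \<in> T\<^sub>A"
proof (cases "\<forall>a\<in>side_A G. a \<in> critical_set G \<longrightarrow> matched M a")
  case True
  show ?thesis by (rule that[of "{}" "{}"]) (use True in auto)
next
  case False
  then obtain a\<^sub>0 where a0: "a\<^sub>0 \<in> side_A G" "\<not> matched M a\<^sub>0" by blast
  let ?t = "card (side_B G)" and ?s = "card (side_A G)"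
  have fin: "finite M" using matching_finite[OF valid matching] .
  have "card M = card (fst ` M)"
    using matching_inj_on(1)[OF matching] by (simp add: card_image)
  also have "\<dots> < ?s"
    by (rule psubset_card_mono)
      (use finite_sides a0 M_edges edge_sides in \<open>force simp: matched_def\<close>)+
  \<comment> \<open>The range starts at \<open>?t + 2\<close> because \<open>?t\<close> and
    \<open>?t + 1\<close> share a class: only from there on does a rejection above level
    \<open>j\<close> force the level of the accepted offer up to at least \<open>j\<close>.\<close>
  finally have "card M < card {?t + 2..<?t + 2 + ?s}" by simp
  then obtain j where "j \<in> {?t + 2..<?t + 2 + ?s}"
    and unused: "j \<notin> (\<lambda>e. lev (fst e) (snd e)) ` M"
    by (rule unused_level[OF fin])
  then have j: "?t + 2 \<le> j" "j < ?t + 2 + ?s" by auto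
  define T\<^sub>A where "T\<^sub>A = {a \<in> critical_set G. \<forall>b. (a, b) \<in> M \<longrightarrow> j < lev a b}"
  define T\<^sub>B where "T\<^sub>B = {b. \<exists>a. (a, b) \<in> M \<and> j < lev a b}"
  show ?thesis
  proof (rule that[of T\<^sub>A T\<^sub>B])
    fix a b assume e: "(a, b) \<in> edges G" and a: "a \<in> T\<^sub>A"
    have lev: "j < lev a b"
    proof (cases "matched M a")
      case True
      then obtain b' where "(a, b') \<in> M" using matched_A edge_sides[OF e] by blast
      then show ?thesis using best[OF _ e, of b'] a by (auto simp: T\<^sub>A_def)
    next
      case False
      then show ?thesis using exhausted[OF e] a j(2) by (auto simp: T\<^sub>A_def last_level_def)
    qed
    then have "first_level G b < lev a b" using j(1) by (auto simp: first_level_def)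
    then obtain a' where a': "(a', b) \<in> M"
      "offer_le ?t (lev a b - 1) (rank G b a) (lev a' b) (rank G b a')"
      using rejected[OF e] by blast
    have "j \<le> lev a' b"
      using offer_le_class[OF a'(2)] lev j(1) by (auto simp: level_class_def split: if_splits)
    moreover have "lev a' b \<noteq> j" using unused a'(1) by force
    ultimately show "b \<in> T\<^sub>B" using a'(1) unfolding T\<^sub>B_def by fastforce
  next
    fix a b assume ab: "(a, b) \<in> M"
    show "a \<in> T\<^sub>A \<longleftrightarrow> b \<in> T\<^sub>B"
      using ab critical_A_if_high[OF ab] j(1)
      unfolding T\<^sub>A_def T\<^sub>B_def by (auto dest: M_unique)
  qed (use j(1) in \<open>auto simp: T\<^sub>A_def T\<^sub>B_def matched_def dest: M_unique\<close>)
qed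

text \<open>Value 1 on every critical vertex is feasible and tight, but violates slackness at
  unmatched critical vertices. These all lie in \<open>S\<^sub>B\<close> or
  \<open>T\<^sub>A\<close>, so one unit is moved from \<open>S\<^sub>B\<close> to
  \<open>S\<^sub>A\<close> and from \<open>T\<^sub>A\<close> to \<open>T\<^sub>B\<close>. Every edge
  that loses a unit at one end gains one at the other, and the vertices that gain are
  matched.\<close>

lemma critical: "critical G M"
proof -
  let ?C = "critical_set G"
  obtain S\<^sub>A S\<^sub>B where S:
    "\<And>a b. (a, b) \<in> M \<Longrightarrow> a \<in> S\<^sub>A \<longleftrightarrow> b \<in> S\<^sub>B"
    "\<And>a b. (a, b) \<in> edges G \<Longrightarrow> b \<in> S\<^sub>B \<Longrightarrow> a \<in> S\<^sub>A"
    "\<And>a b. (a, b) \<in> M \<Longrightarrow> a \<in> S\<^sub>A \<Longrightarrow> lev a b < card (side_B G)"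
    "\<And>a. a \<in> S\<^sub>A \<Longrightarrow> \<exists>b. (a, b) \<in> M"
    "S\<^sub>B \<subseteq> critical_set G"
    "\<And>b. b \<in> side_B G \<Longrightarrow> b \<in> critical_set G \<Longrightarrow> \<not> matched M b \<Longrightarrow> b \<in> S\<^sub>B"
    by (fact low_zone)
  obtain T\<^sub>A T\<^sub>B where T:
    "\<And>a b. (a, b) \<in> edges G \<Longrightarrow> a \<in> T\<^sub>A \<Longrightarrow> b \<in> T\<^sub>B"
    "\<And>a b. (a, b) \<in> M \<Longrightarrow> a \<in> T\<^sub>A \<longleftrightarrow> b \<in> T\<^sub>B"
    "\<And>a b. (a, b) \<in> M \<Longrightarrow> a \<in> T\<^sub>A \<Longrightarrow> card (side_B G) + 1 < lev a b"
    "\<And>b. b \<in> T\<^sub>B \<Longrightarrow> \<exists>a. (a, b) \<in> M"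
    "T\<^sub>A \<subseteq> critical_set G"
    "\<And>a. a \<in> side_A G \<Longrightarrow> a \<in> critical_set G \<Longrightarrow> \<not> matched M a \<Longrightarrow> a \<in> T\<^sub>A"
    by (fact high_zone)
  define y\<^sub>A :: "'v \<Rightarrow> nat" where
    "y\<^sub>A a = (if a \<in> S\<^sub>A then 1 + of_bool (a \<in> ?C) else if a \<in> T\<^sub>A then 0 else of_bool (a \<in> ?C))" for a
  define y\<^sub>B :: "'v \<Rightarrow> nat" where
    "y\<^sub>B b = (if b \<in> T\<^sub>B then 1 + of_bool (b \<in> ?C) else if b \<in> S\<^sub>B then 0 else of_bool (b \<in> ?C))" for b
  show ?thesis
  proof (rule critical_by_duality[OF valid matching, of y\<^sub>A y\<^sub>B])
    fix a b assume e: "(a, b) \<in> edges G"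
    show "of_bool (a \<in> ?C) + of_bool (b \<in> ?C) \<le> y\<^sub>A a + y\<^sub>B b"
      using S(2)[OF e] T(1)[OF e] unfolding y\<^sub>A_def y\<^sub>B_def by auto
  next
    fix a b assume ab: "(a, b) \<in> M"
    \<comment> \<open>A matching edge in both zones would need a level below
      \<open>card (side_B G)\<close> and above \<open>card (side_B G) + 1\<close>.\<close>
    have "\<not> (a \<in> S\<^sub>A \<and> a \<in> T\<^sub>A)" using S(3)[OF ab] T(3)[OF ab] by force
    then show "y\<^sub>A a + y\<^sub>B b \<le> of_bool (a \<in> ?C) + of_bool (b \<in> ?C)"
      using S(1)[OF ab] T(2)[OF ab] S(5) T(5) unfolding y\<^sub>A_def y\<^sub>B_def by auto
  next
    fix a assume "a \<in> side_A G" "\<not> matched M a"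
    then show "y\<^sub>A a = 0"
      using S(4)[of a] T(6)[of a] unfolding y\<^sub>A_def matched_def by auto
  next
    fix b assume "b \<in> side_B G" "\<not> matched M b"
    then show "y\<^sub>B b = 0"
      using T(4)[of b] S(6)[of b] unfolding y\<^sub>B_def matched_def by auto
  qed
qed

text \<open>If \<open>a\<close> is unmatched, or prefers \<open>b\<close> to a noncritical partner,
  then \<open>b\<close> has rejected \<open>a\<close> at level \<open>card (side_B G)\<close> or
  higher. A noncritical partner of \<open>b\<close> sits at level at most
  \<open>card (side_B G) + 1\<close>, so both offers are in the same class, where \<open>b\<close>
  follows its ranks and cannot prefer \<open>a\<close>.\<close>

lemma relaxed_stable: "relaxed_stable G M"
  unfolding relaxed_stable_def
proof (intro allI impI, rule ccontr)
  fix a b assume block: "blocking_pair G M a b"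
    and not_relaxed: "\<not> (matched M a \<and> partner M a \<in> critical_set G \<or>
      matched M b \<and> partner M b \<in> critical_set G)"
  let ?t = "card (side_B G)"
  have e: "(a, b) \<in> edges G" using block by (simp add: blocking_pair_def)
  have lev: "?t < lev a b"
  proof (cases "matched M a")
    case True
    then obtain b' where b': "(a, b') \<in> M" using matched_A edge_sides[OF e] by blast
    then have "b' \<notin> critical_set G" using not_relaxed partner_M True by auto
    then have "?t \<le> lev a b'" using critical_B_if_low[OF M_edges[OF b']] by force
    moreover have "rank G a b < rank G a b'"
      using block True partner_M[OF b'] by (simp add: blocking_pair_def prefers_def)
    ultimately show ?thesis using best[OF b' e] by linarith
  next
    case False
    then show ?thesis using exhausted[OF e] by (simp add: last_level_def)
  qed
  then have "first_level G b < lev a b" by (simp add: first_level_def)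
  then obtain a' where a': "(a', b) \<in> M"
    "offer_le ?t (lev a b - 1) (rank G b a) (lev a' b) (rank G b a')"
    using rejected[OF e] by blast
  have mb: "matched M b" using a'(1) by (auto simp: matched_def)
  then have "a' \<notin> critical_set G" using not_relaxed partner_M[OF a'(1)] by auto
  then have "lev a' b \<le> ?t + 1" using critical_A_if_high[OF a'(1)] by force
  then have "rank G b a' \<le> rank G b a"
    using a'(2) lev by (auto simp: offer_le_def level_class_def split: if_splits)
  moreover have "rank G b a < rank G b a'"
    using block mb partner_M[OF a'(1)] by (simp add: blocking_pair_def prefers_def)
  ultimately show False by simp
qed

text \<open>The unmatched \<open>a\<^sub>0\<close> was rejected by \<open>b\<^sub>1\<close> even at
  its last level, while the unmatched \<open>b\<^sub>0\<close> has rejected nobody and caps the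
  level of the edge at \<open>a\<^sub>1\<close>. This squeezes both offers into the class of
  \<open>card (side_B G)\<close>, makes \<open>a\<^sub>0\<close> and \<open>b\<^sub>0\<close>
  noncritical, and makes the middle edge block \<open>N\<close>.\<close>

lemma no_short_augmenting_path:
  assumes N: "matching G N" "relaxed_stable G N"
    and e: "(a\<^sub>1, b\<^sub>1) \<in> M" "(a\<^sub>0, b\<^sub>1) \<in> N" "(a\<^sub>1, b\<^sub>0) \<in> N"
    and unmatched: "\<not> matched M a\<^sub>0" "\<not> matched M b\<^sub>0"
  shows False
proof -
  let ?t = "card (side_B G)"
  have edges: "(a\<^sub>0, b\<^sub>1) \<in> edges G" "(a\<^sub>1, b\<^sub>0) \<in> edges G" "(a\<^sub>1, b\<^sub>1) \<in> edges G"
    using N(1) e M_edges unfolding matching_def by auto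
  \<comment> \<open>Nonempty sides make the critical case visible in the levels: with
    \<open>0 < ?t\<close> the first level of a critical \<open>b\<close> is below \<open>?t\<close>,
    and with \<open>0 < card (side_A G)\<close> the last level of a critical \<open>a\<close> is
    above \<open>?t + 1\<close>.\<close>
  have t: "0 < ?t" using edge_sides[OF edges(2)] finite_sides by (auto simp: card_gt_0_iff)
  have s: "0 < card (side_A G)"
    using edge_sides[OF edges(2)] finite_sides by (auto simp: card_gt_0_iff)
  have l0: "last_level G a\<^sub>0 < lev a\<^sub>0 b\<^sub>1" using exhausted[OF edges(1) unmatched(1)] .
  then have rej: "first_level G b\<^sub>1 < lev a\<^sub>0 b\<^sub>1"
    by (auto simp: first_level_def last_level_def split: if_splits)
  then obtain a' where "(a', b\<^sub>1) \<in> M"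
    "offer_le ?t (lev a\<^sub>0 b\<^sub>1 - 1) (rank G b\<^sub>1 a\<^sub>0) (lev a' b\<^sub>1) (rank G b\<^sub>1 a')"
    using rejected[OF edges(1)] by blast
  then have offer: "offer_le ?t (lev a\<^sub>0 b\<^sub>1 - 1) (rank G b\<^sub>1 a\<^sub>0) (lev a\<^sub>1 b\<^sub>1) (rank G b\<^sub>1 a\<^sub>1)"
    using M_unique e(1) by metis
  have "lev a\<^sub>1 b\<^sub>0 \<le> first_level G b\<^sub>0"
    using rejected[OF edges(2)] unmatched(2) unfolding matched_def by fastforce
  then have l1: "lev a\<^sub>1 b\<^sub>0 = first_level G b\<^sub>0" using lev_first[OF edges(2)] by simp
  have le: "lev a\<^sub>1 b\<^sub>1 \<le> lev a\<^sub>1 b\<^sub>0" using best[OF e(1) edges(2)] by auto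
  have "b\<^sub>0 \<notin> critical_set G"
    using offer_le_class[OF offer] l0 l1 le t
    by (auto simp: first_level_def last_level_def level_class_def split: if_splits)
  moreover from this have lb: "lev a\<^sub>1 b\<^sub>0 = ?t" using l1 by (simp add: first_level_def)
  moreover have "a\<^sub>0 \<notin> critical_set G"
    using offer_le_class[OF offer] l0 le lb s
    by (auto simp: last_level_def level_class_def split: if_splits)
  \<comment> \<open>The inequality is strict: the losing offer has level \<open>?t + 1\<close> and
    the winning one \<open>?t\<close>, so in a tie of ranks the former would have won.\<close>
  moreover have "lev a\<^sub>1 b\<^sub>1 = ?t" and "rank G b\<^sub>1 a\<^sub>1 < rank G b\<^sub>1 a\<^sub>0"
    using offer l0 le lb
    by (auto simp: offer_le_def last_level_def level_class_def split: if_splits)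
  \<comment> \<open>With equal ranks \<open>b\<^sub>0\<close> would be a free alternative for
    \<open>a\<^sub>1\<close>, and \<open>unsettled\<close> would keep the edge from
    \<open>a\<^sub>0\<close> to \<open>b\<^sub>1\<close> at its first level, against
    \<open>rej\<close>.\<close>
  moreover have "rank G a\<^sub>1 b\<^sub>1 < rank G a\<^sub>1 b\<^sub>0"
    using best[OF e(1) edges(2)] unsettled[OF e(1) edges(2) unmatched(2) _ _ edges(1)] rej calculation
    by force
  moreover have "(a\<^sub>1, b\<^sub>1) \<notin> N"
    using e unmatched matching_unique[OF N(1)] unfolding matched_def by metis
  moreover have "partner N a\<^sub>1 = b\<^sub>0" "partner N b\<^sub>1 = a\<^sub>0"
    using partner_eq[OF valid N(1)] e(2,3) by blast+
  ultimately have "blocking_pair G N a\<^sub>1 b\<^sub>1" and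
    "partner N a\<^sub>1 \<notin> critical_set G" "partner N b\<^sub>1 \<notin> critical_set G"
    using edges(3) by (simp_all add: blocking_pair_def prefers_def)
  then show False using N(2) unfolding relaxed_stable_def by blast
qed

text \<open>An unmatched \<open>a\<close> has been turned down on each of its edges, and a vertex
  that turned someone down is matched.\<close>

lemma no_augmenting_edge:
  assumes "(a, b) \<in> edges G"
  shows "matched M a \<or> matched M b"
proof (rule ccontr)
  assume un: "\<not> (matched M a \<or> matched M b)"
  then have "first_level G b < lev a b"
    using exhausted[OF assms] by (auto simp: first_level_def last_level_def split: if_splits)
  then show False using rejected[OF assms] un by (auto simp: matched_def)
qed

text \<open>The edges of \<open>N\<close> split by which ends \<open>M\<close> covers: both
  (\<open>W\<close>), only the A end (\<open>U\<^sub>A\<close>) or only the B end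
  (\<open>U\<^sub>B\<close>). Each of \<open>W\<close> with \<open>U\<^sub>A\<close>,
  \<open>W\<close> with \<open>U\<^sub>B\<close>, and \<open>U\<^sub>A\<close> with
  \<open>U\<^sub>B\<close> has at most \<open>card M\<close> edges in total; adding the three bounds
  counts \<open>N\<close> twice.\<close>

lemma two_thirds:
  assumes N: "matching G N" "relaxed_stable G N"
  shows "2 * card N \<le> 3 * card M"
proof -
  define W where "W = {e \<in> N. matched M (fst e) \<and> matched M (snd e)}"
  define U\<^sub>A where "U\<^sub>A = {e \<in> N. matched M (fst e) \<and> \<not> matched M (snd e)}"
  define U\<^sub>B where "U\<^sub>B = {e \<in> N. \<not> matched M (fst e) \<and> matched M (snd e)}"
  have fin: "finite M" "finite N" using matching_finite[OF valid] matching N(1) by auto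
  have N_edges: "N \<subseteq> edges G" using N(1) by (simp add: matching_def)
  have N_sides: "fst e \<in> side_A G" "snd e \<in> side_B G" if "e \<in> N" for e
    using that N_edges edge_sides[of "fst e" "snd e"] by auto
  have inj: "inj_on fst N" "inj_on snd N" using matching_inj_on[OF N(1)] by auto
  have finW: "finite W" "finite U\<^sub>A" "finite U\<^sub>B" using fin by (auto simp: W_def U\<^sub>A_def U\<^sub>B_def)
  have "N = W \<union> U\<^sub>A \<union> U\<^sub>B"
    using no_augmenting_edge N_edges unfolding W_def U\<^sub>A_def U\<^sub>B_def by force
  moreover have "W \<inter> U\<^sub>A = {}" "(W \<union> U\<^sub>A) \<inter> U\<^sub>B = {}" by (auto simp: W_def U\<^sub>A_def U\<^sub>B_def)
  ultimately have cN: "card N = card W + card U\<^sub>A + card U\<^sub>B"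
    using finW by (simp add: card_Un_disjoint)
  have "card W + card U\<^sub>A = card (fst ` (W \<union> U\<^sub>A))"
    using finW \<open>W \<inter> U\<^sub>A = {}\<close> inj_on_subset[OF inj(1), of "W \<union> U\<^sub>A"]
    by (simp add: card_image card_Un_disjoint W_def U\<^sub>A_def)
  also have "\<dots> \<le> card (fst ` M)"
    by (rule card_mono)
      (use fin matched_A N_sides in \<open>force simp: W_def U\<^sub>A_def\<close>)+
  finally have A: "card W + card U\<^sub>A \<le> card M" using card_image_le[OF fin(1)] le_trans by blast
  have "W \<inter> U\<^sub>B = {}" by (auto simp: W_def U\<^sub>B_def)
  then have "card W + card U\<^sub>B = card (snd ` (W \<union> U\<^sub>B))"
    using finW inj_on_subset[OF inj(2), of "W \<union> U\<^sub>B"]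
    by (simp add: card_image card_Un_disjoint W_def U\<^sub>B_def)
  also have "\<dots> \<le> card (snd ` M)"
    by (rule card_mono)
      (use fin matched_B N_sides in \<open>force simp: W_def U\<^sub>B_def\<close>)+
  finally have B: "card W + card U\<^sub>B \<le> card M" using card_image_le[OF fin(1)] le_trans by blast
  define V\<^sub>A where "V\<^sub>A = {e \<in> M. fst e \<in> fst ` U\<^sub>A}"
  define V\<^sub>B where "V\<^sub>B = {e \<in> M. snd e \<in> snd ` U\<^sub>B}"
  have "x \<in> fst ` V\<^sub>A" if "x \<in> fst ` U\<^sub>A" for x
  proof -
    have "x \<in> side_A G" "matched M x" using that N_sides by (auto simp: U\<^sub>A_def)
    then obtain b where "(x, b) \<in> M" using matched_A by blast
    then have "(x, b) \<in> V\<^sub>A" using that by (simp add: V\<^sub>A_def)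
    then show ?thesis by (metis fst_conv image_eqI)
  qed
  then have "fst ` U\<^sub>A \<subseteq> fst ` V\<^sub>A" by blast
  moreover have "x \<in> snd ` V\<^sub>B" if "x \<in> snd ` U\<^sub>B" for x
  proof -
    have "x \<in> side_B G" "matched M x" using that N_sides by (auto simp: U\<^sub>B_def)
    then obtain a where "(a, x) \<in> M" using matched_B by blast
    then have "(a, x) \<in> V\<^sub>B" using that by (simp add: V\<^sub>B_def)
    then show ?thesis by (metis snd_conv image_eqI)
  qed
  then have "snd ` U\<^sub>B \<subseteq> snd ` V\<^sub>B" by blast
  moreover have "card (fst ` U\<^sub>A) = card U\<^sub>A" "card (snd ` U\<^sub>B) = card U\<^sub>B"
    using inj_on_subset[OF inj(1), of U\<^sub>A] inj_on_subset[OF inj(2), of U\<^sub>B]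
    by (auto simp: card_image U\<^sub>A_def U\<^sub>B_def)
  moreover have finV: "finite V\<^sub>A" "finite V\<^sub>B" using fin by (auto simp: V\<^sub>A_def V\<^sub>B_def)
  ultimately have "card U\<^sub>A \<le> card V\<^sub>A" "card U\<^sub>B \<le> card V\<^sub>B"
    using surj_card_le[of V\<^sub>A "fst ` U\<^sub>A" fst] surj_card_le[of V\<^sub>B "snd ` U\<^sub>B" snd] by simp_all
  \<comment> \<open>A common edge of \<open>M\<close> would be the middle of an augmenting path with
    three edges.\<close>
  moreover have "V\<^sub>A \<inter> V\<^sub>B = {}"
    using no_short_augmenting_path[OF N] unfolding V\<^sub>A_def V\<^sub>B_def U\<^sub>A_def U\<^sub>B_def by fastforce
  then have "card V\<^sub>A + card V\<^sub>B \<le> card M"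
    using card_mono[OF fin(1), of "V\<^sub>A \<union> V\<^sub>B"] finV
    by (auto simp: card_Un_disjoint V\<^sub>A_def V\<^sub>B_def)
  ultimately show ?thesis using A B cN by linarith
qed

end

section \<open>The proposal procedure on edge indices\<close>

lemma offer_le_trans:
  "offer_le t c r c' r' \<Longrightarrow> offer_le t c' r' c'' r'' \<Longrightarrow> offer_le t c r c'' r''"
  unfolding offer_le_def by auto

lemma offer_le_linear: "offer_le t c r c' r' \<or> offer_le t c' r' c r"
  unfolding offer_le_def by auto

text \<open>Vertices and edges become array positions, so that the invariant can be stated directly
  about the memory of the machine.\<close>

locale edge_list =
  fixes n\<^sub>A n\<^sub>B m :: nat and end\<^sub>A end\<^sub>B rank\<^sub>A rank\<^sub>B :: "nat \<Rightarrow> nat" and crit\<^sub>A crit\<^sub>B :: "nat \<Rightarrow> bool"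
  assumes end_less: "k < m \<Longrightarrow> end\<^sub>A k < n\<^sub>A" "k < m \<Longrightarrow> end\<^sub>B k < n\<^sub>B"
    and end_inj: "k < m \<Longrightarrow> l < m \<Longrightarrow> end\<^sub>A k = end\<^sub>A l \<Longrightarrow> end\<^sub>B k = end\<^sub>B l \<Longrightarrow> k = l"
begin

definition fst_lev :: "nat \<Rightarrow> nat" where
  "fst_lev k = (if crit\<^sub>B (end\<^sub>B k) then 0 else n\<^sub>B)"

definition lst_lev :: "nat \<Rightarrow> nat" where
  "lst_lev k = n\<^sub>B + 1 + (if crit\<^sub>A (end\<^sub>A k) then n\<^sub>A else 0)"

text \<open>
  The state of the algorithm: \<open>lev k\<close> is the level at which edge \<open>k\<close> is proposed next, \<open>m\<^sub>A\<close> flags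
  the matched vertices of the one side, and \<open>m\<^sub>B j\<close> is the successor of the index of the matching
  edge at \<open>j\<close>, or 0.
\<close>

definition in_M :: "(nat \<Rightarrow> nat) \<Rightarrow> nat \<Rightarrow> bool" where
  "in_M m\<^sub>B k \<longleftrightarrow> k < m \<and> m\<^sub>B (end\<^sub>B k) = Suc k"

definition alternative :: "(nat \<Rightarrow> nat) \<Rightarrow> (nat \<Rightarrow> nat) \<Rightarrow> nat \<Rightarrow> nat \<Rightarrow> bool" where
  "alternative lev m\<^sub>B f l \<longleftrightarrow>
     end\<^sub>A l = end\<^sub>A f \<and> m\<^sub>B (end\<^sub>B l) = 0 \<and> lev l = lev f \<and> rank\<^sub>A l = rank\<^sub>A f"

definition candidate :: "(nat \<Rightarrow> nat) \<Rightarrow> (nat \<Rightarrow> nat) \<Rightarrow> nat \<Rightarrow> bool" where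
  "candidate lev m\<^sub>A k \<longleftrightarrow> m\<^sub>A (end\<^sub>A k) = 0 \<and> lev k \<le> lst_lev k"

text \<open>The last criterion ensures that an edge chosen towards a matched vertex has no
  alternative itself.\<close>

definition sooner :: "(nat \<Rightarrow> nat) \<Rightarrow> (nat \<Rightarrow> nat) \<Rightarrow> nat \<Rightarrow> nat \<Rightarrow> bool" where
  "sooner lev m\<^sub>B k l \<longleftrightarrow> lev k < lev l \<or> lev k = lev l \<and>
     (rank\<^sub>A k < rank\<^sub>A l \<or> rank\<^sub>A k = rank\<^sub>A l \<and> m\<^sub>B (end\<^sub>B k) = 0 \<and> 0 < m\<^sub>B (end\<^sub>B l))"

definition chosen :: "(nat \<Rightarrow> nat) \<Rightarrow> (nat \<Rightarrow> nat) \<Rightarrow> (nat \<Rightarrow> nat) \<Rightarrow> nat \<Rightarrow> bool" where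
  "chosen lev m\<^sub>A m\<^sub>B k \<longleftrightarrow> k < m \<and> candidate lev m\<^sub>A k \<and>
     (\<forall>l<m. candidate lev m\<^sub>A l \<longrightarrow> \<not> sooner lev m\<^sub>B l k)"

text \<open>A step either raises a level or matches a new vertex of side B, so one summand falls and
  the other does not grow. The \<open>+ 1\<close> lets the raise past the last level count as
  well.\<close>

definition potential :: "(nat \<Rightarrow> nat) \<Rightarrow> (nat \<Rightarrow> nat) \<Rightarrow> nat" where
  "potential lev m\<^sub>B = (\<Sum>k<m. lst_lev k + 1 - lev k) + card {j. j < n\<^sub>B \<and> m\<^sub>B j = 0}"

lemma potential_raise:
  assumes "k < m" and "lev k \<le> lst_lev k" and "\<And>j. m\<^sub>B' j = 0 \<Longrightarrow> m\<^sub>B j = 0"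
  shows "potential (lev(k := Suc (lev k))) m\<^sub>B' < potential lev m\<^sub>B"
proof -
  have "(\<Sum>l<m. lst_lev l + 1 - (lev(k := Suc (lev k))) l) < (\<Sum>l<m. lst_lev l + 1 - lev l)"
    by (rule sum_strict_mono_ex1) (use assms in auto)
  moreover have "card {j. j < n\<^sub>B \<and> m\<^sub>B' j = 0} \<le> card {j. j < n\<^sub>B \<and> m\<^sub>B j = 0}"
    by (rule card_mono) (use assms(3) in auto)
  ultimately show ?thesis unfolding potential_def by linarith
qed

lemma potential_match:
  assumes "i < n\<^sub>B" and "m\<^sub>B i = 0" and "m\<^sub>B' i \<noteq> 0" and "\<And>j. m\<^sub>B' j = 0 \<Longrightarrow> m\<^sub>B j = 0"
  shows "potential lev m\<^sub>B' < potential lev m\<^sub>B"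
proof -
  have "i \<in> {j. j < n\<^sub>B \<and> m\<^sub>B j = 0} - {j. j < n\<^sub>B \<and> m\<^sub>B' j = 0}" using assms by simp
  then have "{j. j < n\<^sub>B \<and> m\<^sub>B' j = 0} \<subset> {j. j < n\<^sub>B \<and> m\<^sub>B j = 0}" using assms(4) by blast
  then have "card {j. j < n\<^sub>B \<and> m\<^sub>B' j = 0} < card {j. j < n\<^sub>B \<and> m\<^sub>B j = 0}"
    by (intro psubset_card_mono) auto
  then show ?thesis unfolding potential_def by linarith
qed

end

text \<open>\<open>lev_ge\<close>, \<open>in_M_lev\<close>, \<open>in_M_best\<close>,
  \<open>raised\<close> and \<open>unsettled\<close> are the indexed forms of the assumptions of
  \<open>proposal_outcome\<close>. Its \<open>exhausted\<close> is absent because it becomes true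
  only when no candidate is left.\<close>

locale proposal_state = edge_list +
  fixes lev m\<^sub>A m\<^sub>B out :: "nat \<Rightarrow> nat"
  assumes m\<^sub>B_edge: "m\<^sub>B j = Suc k \<Longrightarrow> k < m \<and> end\<^sub>B k = j"
    and in_M_inj: "in_M m\<^sub>B k \<Longrightarrow> in_M m\<^sub>B l \<Longrightarrow> end\<^sub>A k = end\<^sub>A l \<Longrightarrow> k = l"
    and in_M_m\<^sub>A: "in_M m\<^sub>B k \<Longrightarrow> m\<^sub>A (end\<^sub>A k) \<noteq> 0"
    and m\<^sub>A_in_M: "m\<^sub>A i \<noteq> 0 \<Longrightarrow> \<exists>k. in_M m\<^sub>B k \<and> end\<^sub>A k = i"
    and lev_ge: "k < m \<Longrightarrow> fst_lev k \<le> lev k"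
    and lev_le: "k < m \<Longrightarrow> lev k \<le> lst_lev k + 1"
    and in_M_lev: "in_M m\<^sub>B k \<Longrightarrow> lev k \<le> lst_lev k"
    and in_M_best: "in_M m\<^sub>B k \<Longrightarrow> l < m \<Longrightarrow> end\<^sub>A l = end\<^sub>A k \<Longrightarrow>
      lev k < lev l \<or> lev k = lev l \<and> rank\<^sub>A k \<le> rank\<^sub>A l"
    and raised: "l < m \<Longrightarrow> fst_lev l < lev l \<Longrightarrow>
      \<exists>f. m\<^sub>B (end\<^sub>B l) = Suc f \<and> offer_le n\<^sub>B (lev l - 1) (rank\<^sub>B l) (lev f) (rank\<^sub>B f)"
    and unsettled: "in_M m\<^sub>B f \<Longrightarrow> l < m \<Longrightarrow> alternative lev m\<^sub>B f l \<Longrightarrow>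
      k < m \<Longrightarrow> end\<^sub>B k = end\<^sub>B f \<Longrightarrow> lev k = fst_lev k"
    and out_iff: "k < m \<Longrightarrow> out k \<noteq> 0 \<longleftrightarrow> in_M m\<^sub>B k"
begin

lemma in_M_partner: "m\<^sub>B j = Suc f \<Longrightarrow> in_M m\<^sub>B f \<and> end\<^sub>B f = j"
  using m\<^sub>B_edge unfolding in_M_def by blast

lemma not_raised_if_free: "l < m \<Longrightarrow> m\<^sub>B (end\<^sub>B l) = 0 \<Longrightarrow> lev l = fst_lev l"
  using raised[of l] lev_ge[of l] by fastforce

section \<open>The four possible outcomes of one proposal preserve the invariant\<close>

context
  fixes k assumes chosen: "chosen lev m\<^sub>A m\<^sub>B k"
begin

lemma chosen_less: "k < m" and chosen_free: "m\<^sub>A (end\<^sub>A k) = 0" and chosen_lev: "lev k \<le> lst_lev k"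
  using chosen unfolding chosen_def candidate_def by auto

text \<open>The last level depends on the proposer only, so an edge of the same proposer at the
  level of \<open>k\<close> or lower is a candidate too and cannot be sooner.\<close>

lemma chosen_best:
  assumes "l < m" and "end\<^sub>A l = end\<^sub>A k"
  shows "lev k < lev l \<or> lev k = lev l \<and> rank\<^sub>A k \<le> rank\<^sub>A l"
    and "alternative lev m\<^sub>B k l \<Longrightarrow> m\<^sub>B (end\<^sub>B k) = 0"
proof -
  have "lst_lev l = lst_lev k" using assms(2) by (simp add: lst_lev_def)
  then have *: "lev k < lev l \<or> \<not> sooner lev m\<^sub>B l k"
    using chosen assms unfolding chosen_def candidate_def by force
  then show "lev k < lev l \<or> lev k = lev l \<and> rank\<^sub>A k \<le> rank\<^sub>A l"
    unfolding sooner_def by auto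
  show "alternative lev m\<^sub>B k l \<Longrightarrow> m\<^sub>B (end\<^sub>B k) = 0"
    using * unfolding sooner_def alternative_def by auto
qed

lemma not_in_M_chosen: "in_M m\<^sub>B l \<Longrightarrow> end\<^sub>A l \<noteq> end\<^sub>A k"
  using in_M_m\<^sub>A chosen_free by metis

text \<open>No level changes and no further alternative arises. At the newly matched vertex nothing
  was ever raised, so \<open>unsettled\<close> holds for \<open>k\<close> even if \<open>k\<close>
  has an alternative.\<close>

lemma match_free:
  assumes free: "m\<^sub>B (end\<^sub>B k) = 0"
  shows "proposal_state n\<^sub>A n\<^sub>B m end\<^sub>A end\<^sub>B rank\<^sub>A rank\<^sub>B crit\<^sub>A crit\<^sub>B
      lev (m\<^sub>A(end\<^sub>A k := 1)) (m\<^sub>B(end\<^sub>B k := Suc k)) (out(k := 1))"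
    and "potential lev (m\<^sub>B(end\<^sub>B k := Suc k)) < potential lev m\<^sub>B"
proof -
  let ?A = "m\<^sub>A(end\<^sub>A k := 1)" and ?B = "m\<^sub>B(end\<^sub>B k := Suc k)" and ?O = "out(k := 1)"
  have inM: "in_M ?B l \<longleftrightarrow> l = k \<or> in_M m\<^sub>B l" for l
    using free chosen_less by (auto simp: in_M_def)
  have alt: "alternative lev ?B f l \<Longrightarrow> alternative lev m\<^sub>B f l" for f l
    by (auto simp: alternative_def split: if_splits)
  show "proposal_state n\<^sub>A n\<^sub>B m end\<^sub>A end\<^sub>B rank\<^sub>A rank\<^sub>B crit\<^sub>A crit\<^sub>B lev ?A ?B ?O"
  proof (unfold_locales, goal_cases)
    case (1 j l) then show ?case using m\<^sub>B_edge chosen_less by (auto split: if_splits)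
  next
    case (2 l l') then show ?case using in_M_inj not_in_M_chosen unfolding inM by metis
  next
    case (3 l) then show ?case using in_M_m\<^sub>A unfolding inM by auto
  next
    case (4 i) then show ?case using m\<^sub>A_in_M unfolding inM by (auto split: if_splits)
  next
    case (5 l) then show ?case by (rule lev_ge)
  next
    case (6 l) then show ?case by (rule lev_le)
  next
    case (7 l) then show ?case using in_M_lev chosen_lev unfolding inM by auto
  next
    case (8 l l') then show ?case using in_M_best chosen_best(1) unfolding inM by blast
  next
    case (9 l) then show ?case using raised[of l] free by fastforce
  next
    case (10 f l l') then show ?case
      using unsettled alt not_raised_if_free free unfolding inM by metis
  next
    case (11 l) then show ?case using out_iff unfolding inM by auto
  qed
  show "potential lev ?B < potential lev m\<^sub>B"
    by (rule potential_match[of "end\<^sub>B k"]) (use free end_less chosen_less in \<open>auto split: if_splits\<close>)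
qed

text \<open>The old partner moves to an edge of equal level and rank, hence still a best one. No
  edge at either vertex of side B is raised: at \<open>end\<^sub>B k\<close> by
  \<open>unsettled\<close>, at \<open>end\<^sub>B l\<close> because it was free. The potential falls
  because \<open>end\<^sub>B l\<close> becomes matched.\<close>

lemma rematch:
  assumes f: "m\<^sub>B (end\<^sub>B k) = Suc f" and l: "l < m" "alternative lev m\<^sub>B f l"
  shows "proposal_state n\<^sub>A n\<^sub>B m end\<^sub>A end\<^sub>B rank\<^sub>A rank\<^sub>B crit\<^sub>A crit\<^sub>B lev (m\<^sub>A(end\<^sub>A k := 1))
      (m\<^sub>B(end\<^sub>B k := Suc k, end\<^sub>B l := Suc l)) (out(f := 0, k := 1, l := 1))"
    and "potential lev (m\<^sub>B(end\<^sub>B k := Suc k, end\<^sub>B l := Suc l)) < potential lev m\<^sub>B"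
proof -
  let ?A = "m\<^sub>A(end\<^sub>A k := 1)" and ?B = "m\<^sub>B(end\<^sub>B k := Suc k, end\<^sub>B l := Suc l)"
    and ?O = "out(f := 0, k := 1, l := 1)"
  have fM: "in_M m\<^sub>B f" "end\<^sub>B f = end\<^sub>B k" using in_M_partner[OF f] by auto
  have l': "end\<^sub>A l = end\<^sub>A f" "m\<^sub>B (end\<^sub>B l) = 0" "lev l = lev f" "rank\<^sub>A l = rank\<^sub>A f"
    using l(2) by (auto simp: alternative_def)
  have ne: "end\<^sub>B l \<noteq> end\<^sub>B k" "end\<^sub>A f \<noteq> end\<^sub>A k" "k \<noteq> l" "f \<noteq> k" "f \<noteq> l"
    using l' f not_in_M_chosen[OF fM(1)] fM(2) by auto
  have lst: "lst_lev l = lst_lev f" using l'(1) by (simp add: lst_lev_def)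
  have inM: "in_M ?B e \<longleftrightarrow> e = k \<or> e = l \<or> in_M m\<^sub>B e \<and> e \<noteq> f" for e
    using ne l' l(1) f fM(2) chosen_less by (auto simp: in_M_def)
  have alt: "alternative lev ?B g e \<Longrightarrow> alternative lev m\<^sub>B g e" for g e
    by (auto simp: alternative_def split: if_splits)
  have altk: "\<not> alternative lev m\<^sub>B k e" if "e < m" for e
    using chosen_best(2)[OF that] f unfolding alternative_def by auto
  have unraised: "lev e = fst_lev e" if "e < m" "end\<^sub>B e = end\<^sub>B k \<or> end\<^sub>B e = end\<^sub>B l" for e
    using that unsettled[OF fM(1) l] not_raised_if_free l' fM(2) by metis
  have M_l: "e = f" if "in_M m\<^sub>B e" "end\<^sub>A e = end\<^sub>A l" for e
    using in_M_inj[OF that(1) fM(1)] that(2) l' by simp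
  show "proposal_state n\<^sub>A n\<^sub>B m end\<^sub>A end\<^sub>B rank\<^sub>A rank\<^sub>B crit\<^sub>A crit\<^sub>B lev ?A ?B ?O"
  proof (unfold_locales, goal_cases)
    case (1 j e) then show ?case using m\<^sub>B_edge chosen_less l(1) by (auto split: if_splits)
  next
    case (2 e e') then show ?case
      using in_M_inj not_in_M_chosen M_l ne l'(1) unfolding inM by metis
  next
    case (3 e) then show ?case using in_M_m\<^sub>A fM(1) l'(1) unfolding inM by auto
  next
    case (4 i) then show ?case using m\<^sub>A_in_M[of i] l'(1) unfolding inM by (auto split: if_splits)
  next
    case (5 e) then show ?case by (rule lev_ge)
  next
    case (6 e) then show ?case by (rule lev_le)
  next
    case (7 e) then show ?case
      using in_M_lev[of e] in_M_lev[OF fM(1)] chosen_lev l' lst unfolding inM by auto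
  next
    case (8 e e') then show ?case
      using in_M_best chosen_best(1) fM(1) l' unfolding inM by metis
  next
    case (9 e)
    then have "end\<^sub>B e \<noteq> end\<^sub>B k" "end\<^sub>B e \<noteq> end\<^sub>B l" using unraised by force+
    then show ?case using raised[of e] 9 by auto
  next
    case (10 g e e')
    then show ?case using unsettled alt altk unraised unfolding inM by metis
  next
    case (11 e) then show ?case using out_iff ne unfolding inM by auto
  qed
  show "potential lev ?B < potential lev m\<^sub>B"
    by (rule potential_match[of "end\<^sub>B l"]) (use l' end_less l(1) in \<open>auto split: if_splits\<close>)
qed

text \<open>The order of offers is total, so the displaced offer is dominated by the new one, and by
  transitivity so is every offer rejected earlier. The displaced proposer becomes free, so no
  matching edge has to compete with its raised edge.\<close>

lemma replace:
  assumes f: "m\<^sub>B (end\<^sub>B k) = Suc f" and settled: "\<And>l. l < m \<Longrightarrow> \<not> alternative lev m\<^sub>B f l"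
    and better: "\<not> offer_le n\<^sub>B (lev k) (rank\<^sub>B k) (lev f) (rank\<^sub>B f)"
  shows "proposal_state n\<^sub>A n\<^sub>B m end\<^sub>A end\<^sub>B rank\<^sub>A rank\<^sub>B crit\<^sub>A crit\<^sub>B (lev(f := Suc (lev f)))
      (m\<^sub>A(end\<^sub>A f := 0, end\<^sub>A k := 1)) (m\<^sub>B(end\<^sub>B k := Suc k)) (out(f := 0, k := 1))"
    and "potential (lev(f := Suc (lev f))) (m\<^sub>B(end\<^sub>B k := Suc k)) < potential lev m\<^sub>B"
proof -
  let ?L = "lev(f := Suc (lev f))" and ?A = "m\<^sub>A(end\<^sub>A f := 0, end\<^sub>A k := 1)"
    and ?B = "m\<^sub>B(end\<^sub>B k := Suc k)" and ?O = "out(f := 0, k := 1)"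
  have fM: "in_M m\<^sub>B f" "end\<^sub>B f = end\<^sub>B k" "f < m"
    using in_M_partner[OF f] by (auto simp: in_M_def)
  have ne: "end\<^sub>A f \<noteq> end\<^sub>A k" "f \<noteq> k" using not_in_M_chosen[OF fM(1)] by auto
  have inM: "in_M ?B e \<longleftrightarrow> e = k \<or> in_M m\<^sub>B e \<and> e \<noteq> f" for e
    using ne f fM(2) chosen_less by (auto simp: in_M_def)
  have M_f: "e = f" if "in_M m\<^sub>B e" "end\<^sub>A e = end\<^sub>A f" for e
    using in_M_inj[OF that(1) fM(1)] that(2) by simp
  have alt: "alternative ?L ?B g e \<Longrightarrow> g \<noteq> f \<Longrightarrow> alternative lev m\<^sub>B g e" for g e
    using fM(2) by (auto simp: alternative_def split: if_splits)
  have altk: "\<not> alternative lev m\<^sub>B k e" if "e < m" for e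
    using chosen_best(2)[OF that] f unfolding alternative_def by auto
  have offer: "offer_le n\<^sub>B (lev f) (rank\<^sub>B f) (lev k) (rank\<^sub>B k)"
    using better offer_le_linear by blast
  show "proposal_state n\<^sub>A n\<^sub>B m end\<^sub>A end\<^sub>B rank\<^sub>A rank\<^sub>B crit\<^sub>A crit\<^sub>B ?L ?A ?B ?O"
  proof (unfold_locales, goal_cases)
    case (1 j e) then show ?case using m\<^sub>B_edge chosen_less by (auto split: if_splits)
  next
    case (2 e e') then show ?case using in_M_inj not_in_M_chosen unfolding inM by metis
  next
    case (3 e) then show ?case using in_M_m\<^sub>A M_f ne unfolding inM by auto
  next
    case (4 i) then show ?case using m\<^sub>A_in_M[of i] unfolding inM by (auto split: if_splits)
  next
    case (5 e) then show ?case using lev_ge[of e] by (auto simp: le_SucI)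
  next
    case (6 e) then show ?case using lev_le[of e] in_M_lev[OF fM(1)] by auto
  next
    case (7 e) then show ?case using in_M_lev chosen_lev ne unfolding inM by auto
  next
    case (8 e e')
    then have "e \<noteq> f" "e' \<noteq> f" using M_f ne unfolding inM by metis+
    then show ?case using 8 in_M_best chosen_best(1) unfolding inM by auto
  next
    case (9 e)
    show ?case
    proof (cases "end\<^sub>B e = end\<^sub>B k")
      case True
      \<comment> \<open>For \<open>e = f\<close> subtracting 1 undoes the raise, leaving
        reflexivity; any other edge at this vertex was already dominated by
        \<open>f\<close>.\<close>
      have "offer_le n\<^sub>B (?L e - 1) (rank\<^sub>B e) (lev f) (rank\<^sub>B f)"
        using 9 raised[of e] True f by (cases "e = f") (auto simp: offer_le_def)
      then show ?thesis using True ne offer offer_le_trans by auto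
    next
      case False
      then have "e \<noteq> f" using fM(2) by auto
      then obtain g where g: "m\<^sub>B (end\<^sub>B e) = Suc g"
        "offer_le n\<^sub>B (lev e - 1) (rank\<^sub>B e) (lev g) (rank\<^sub>B g)"
        using 9 raised[of e] by auto
      moreover have "g \<noteq> f" using g(1) in_M_partner fM(2) False by metis
      ultimately show ?thesis using False \<open>e \<noteq> f\<close> by auto
    qed
  next
    case (10 g e e')
    then have "g \<noteq> f" using inM ne by blast
    then have a: "alternative lev m\<^sub>B g e" using alt 10 by blast
    then have g: "in_M m\<^sub>B g" using 10 altk unfolding inM by blast
    then have "end\<^sub>B g \<noteq> end\<^sub>B k" using f \<open>g \<noteq> f\<close> unfolding in_M_def by auto
    then have "e' \<noteq> f" using 10 fM(2) by auto
    then show ?case using unsettled[OF g _ a] 10 by auto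
  next
    case (11 e) then show ?case using out_iff ne unfolding inM by auto
  qed
  show "potential ?L ?B < potential lev m\<^sub>B"
    by (rule potential_raise) (use fM in_M_lev in \<open>auto split: if_splits\<close>)
qed

text \<open>The raise records a rejection at the old level of \<open>k\<close>, which
  \<open>worse\<close> justifies. Since it destroys the conclusion of \<open>unsettled\<close> for
  the partner edge \<open>f\<close>, \<open>settled\<close> must rule out alternatives for
  \<open>f\<close>.\<close>

lemma reject:
  assumes f: "m\<^sub>B (end\<^sub>B k) = Suc f" and settled: "\<And>l. l < m \<Longrightarrow> \<not> alternative lev m\<^sub>B f l"
    and worse: "offer_le n\<^sub>B (lev k) (rank\<^sub>B k) (lev f) (rank\<^sub>B f)"
  shows "proposal_state n\<^sub>A n\<^sub>B m end\<^sub>A end\<^sub>B rank\<^sub>A rank\<^sub>B crit\<^sub>A crit\<^sub>B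
      (lev(k := Suc (lev k))) m\<^sub>A m\<^sub>B out"
    and "potential (lev(k := Suc (lev k))) m\<^sub>B < potential lev m\<^sub>B"
proof -
  let ?L = "lev(k := Suc (lev k))"
  have fM: "in_M m\<^sub>B f" "end\<^sub>B f = end\<^sub>B k" "f < m"
    using in_M_partner[OF f] by (auto simp: in_M_def)
  have ne: "e \<noteq> k" if "in_M m\<^sub>B e" for e using not_in_M_chosen[OF that] by auto
  show "proposal_state n\<^sub>A n\<^sub>B m end\<^sub>A end\<^sub>B rank\<^sub>A rank\<^sub>B crit\<^sub>A crit\<^sub>B ?L m\<^sub>A m\<^sub>B out"
  proof (unfold_locales, goal_cases)
    case (1 j e) then show ?case by (rule m\<^sub>B_edge)
  next
    case (2 e e') then show ?case by (rule in_M_inj)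
  next
    case (3 e) then show ?case using in_M_m\<^sub>A by auto
  next
    case (4 i) then show ?case by (simp add: m\<^sub>A_in_M)
  next
    case (5 e) then show ?case using lev_ge[of e] by (auto simp: le_SucI)
  next
    case (6 e) then show ?case using lev_le[of e] chosen_lev by auto
  next
    case (7 e) then show ?case using in_M_lev ne by auto
  next
    case (8 e e')
    then have "e \<noteq> k" "e' \<noteq> k" using not_in_M_chosen by force+
    then show ?case using 8 in_M_best by auto
  next
    case (9 e)
    show ?case
    proof (cases "e = k")
      case True
      then show ?thesis using f worse ne[OF fM(1)] by auto
    next
      case False
      then obtain g where g: "m\<^sub>B (end\<^sub>B e) = Suc g"
        "offer_le n\<^sub>B (lev e - 1) (rank\<^sub>B e) (lev g) (rank\<^sub>B g)"
        using 9 raised[of e] by auto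
      then show ?thesis using False ne in_M_partner by auto
    qed
  next
    case (10 g e e')
    have "g \<noteq> k" "e \<noteq> k" using 10 ne f by (auto simp: alternative_def)
    then have a: "alternative lev m\<^sub>B g e" using 10 by (auto simp: alternative_def)
    then have "g \<noteq> f" using settled 10 by blast
    then have "e' \<noteq> k" using 10 f unfolding in_M_def by auto
    then show ?case using unsettled[OF _ _ a] 10 by auto
  next
    case (11 e) then show ?case by (rule out_iff)
  qed
  show "potential ?L m\<^sub>B < potential lev m\<^sub>B"
    by (rule potential_raise) (use chosen_less chosen_lev in auto)
qed

end

end

lemma (in edge_list) proposal_state_init:
  assumes "\<And>k. k < m \<Longrightarrow> lev k = fst_lev k"
  shows "proposal_state n\<^sub>A n\<^sub>B m end\<^sub>A end\<^sub>B rank\<^sub>A rank\<^sub>B crit\<^sub>A crit\<^sub>B lev (\<lambda>_. 0) (\<lambda>_. 0) (\<lambda>_. 0)"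
  by unfold_locales (auto simp: assms in_M_def fst_lev_def lst_lev_def)

section \<open>The program and its running time\<close>

fun loop_free :: "com \<Rightarrow> bool" where
  "loop_free (Seq c d) \<longleftrightarrow> loop_free c \<and> loop_free d"
| "loop_free (If b c d) \<longleftrightarrow> loop_free c \<and> loop_free d"
| "loop_free (While b c) \<longleftrightarrow> False"
| "loop_free _ \<longleftrightarrow> True"

text \<open>The \<open>While\<close> equation is a dummy value; agreement with \<open>exec\<close>
  is claimed for loop-free code only.\<close>

fun run :: "com \<Rightarrow> state \<Rightarrow> state" where
  "run Skip s = s"
| "run (Store x i e) s = s(x := (s x)(aval i s := aval e s))"
| "run (Seq c d) s = run d (run c s)"
| "run (If b c d) s = (if bval b s then run c s else run d s)"
| "run (While b c) s = s"

text \<open>For loop-free code this is an upper bound independent of the state, as both branches of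
  a conditional are charged.\<close>

fun cost :: "com \<Rightarrow> nat" where
  "cost (Seq c d) = cost c + cost d"
| "cost (If b c d) = cost c + cost d + 1"
| "cost _ = 1"

definition halts :: "com \<Rightarrow> state \<Rightarrow> nat \<Rightarrow> (state \<Rightarrow> bool) \<Rightarrow> bool" where
  "halts c s T Q \<longleftrightarrow> (\<exists>t s'. exec c s t s' \<and> t \<le> T \<and> Q s')"

lemma halts_run: "loop_free c \<Longrightarrow> Q (run c s) \<Longrightarrow> halts c s (cost c) Q"
proof -
  have "loop_free c \<Longrightarrow> \<exists>t \<le> cost c. exec c s t (run c s)"
  proof (induction c arbitrary: s)
    case (Seq c d)
    then obtain t u where "t \<le> cost c" "exec c s t (run c s)" "u \<le> cost d"
      "exec d (run c s) u (run d (run c s))" by (meson loop_free.simps(1))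
    then show ?case using exec.Seq add_mono by fastforce
  next
    case (If b c d)
    then obtain t u where "t \<le> cost c" "exec c s t (run c s)" "u \<le> cost d"
      "exec d s u (run d s)" by (meson loop_free.simps(2))
    then show ?case
      using exec.IfTrue[of b s c t "run c s" d] exec.IfFalse[of b s d u "run d s" c]
      by (cases "bval b s") (auto intro: exI[of _ "t + 1"] exI[of _ "u + 1"])
  qed (auto intro: exec.Skip exec.Store simp flip: One_nat_def)
  then show "loop_free c \<Longrightarrow> Q (run c s) \<Longrightarrow> halts c s (cost c) Q"
    unfolding halts_def by blast
qed

lemma halts_mono:
  "halts c s T Q \<Longrightarrow> T \<le> T' \<Longrightarrow> (\<And>s'. Q s' \<Longrightarrow> Q' s') \<Longrightarrow> halts c s T' Q'"
  unfolding halts_def by (meson le_trans)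

lemma halts_Seq:
  assumes "halts c s T R" and "\<And>s'. R s' \<Longrightarrow> halts d s' U Q"
  shows "halts (Seq c d) s (T + U) Q"
  using assms unfolding halts_def by (meson add_mono exec.Seq)

lemma halts_run_Seq:
  assumes "loop_free c" and "halts d (run c s) U Q"
  shows "halts (Seq c d) s (cost c + U) Q"
  by (rule halts_Seq[OF halts_run[where Q = "\<lambda>s'. s' = run c s"]]) (use assms in auto)

text \<open>The measure bounds the number of rounds. Each round costs at most \<open>T\<close> and
  one step for the test; the last \<open>+ 1\<close> is the failing test.\<close>

lemma halts_While:
  assumes "I s" and "\<And>s. I s \<Longrightarrow> bval b s \<Longrightarrow> halts c s T (\<lambda>s'. I s' \<and> \<mu> s' < (\<mu> s :: nat))"
  shows "halts (While b c) s (\<mu> s * (T + 1) + 1) (\<lambda>s'. I s' \<and> \<not> bval b s')"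
  using assms(1)
proof (induction "\<mu> s" arbitrary: s rule: less_induct)
  case less
  show ?case
  proof (cases "bval b s")
    case True
    then obtain t s' where s': "exec c s t s'" "t \<le> T" "I s'" "\<mu> s' < \<mu> s"
      using assms(2) less.prems unfolding halts_def by blast
    then obtain u s'' where s'': "exec (While b c) s' u s''" "u \<le> \<mu> s' * (T + 1) + 1"
      "I s''" "\<not> bval b s''"
      using less.hyps unfolding halts_def by blast
    have "(\<mu> s' + 1) * (T + 1) \<le> \<mu> s * (T + 1)" using s'(4) by (intro mult_right_mono) auto
    then have "t + u + 1 \<le> \<mu> s * (T + 1) + 1" using s'(2) s''(2) by (simp add: algebra_simps)
    then show ?thesis
      using exec.WhileTrue[OF True s'(1) s''(1)] s'' unfolding halts_def by blast
  next
    case False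
    then show ?thesis using exec.WhileFalse less.prems unfolding halts_def by fastforce
  qed
qed

section \<open>The program text\<close>

abbreviation scalar :: "vname \<Rightarrow> aexp" where
  "scalar x \<equiv> Acc x (Lit 0)"

definition Or :: "bexp \<Rightarrow> bexp \<Rightarrow> bexp" where
  "Or b c = Not (And (Not b) (Not c))"

definition Eq :: "aexp \<Rightarrow> aexp \<Rightarrow> bexp" where
  "Eq e f = And (Not (Less e f)) (Not (Less f e))"

lemma bval_Or_Eq [simp]:
  "bval (Or b c) s \<longleftrightarrow> bval b s \<or> bval c s"
  "bval (Eq e f) s \<longleftrightarrow> aval e s = aval f s"
  by (auto simp: Or_def Eq_def)

definition for_edges :: "com \<Rightarrow> com" where
  "for_edges c = Seq (Store ''k'' (Lit 0) (Lit 0))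
     (While (Less (scalar ''k'') (scalar ''num_E''))
        (Seq c (Store ''k'' (Lit 0) (Plus (scalar ''k'') (Lit 1)))))"

text \<open>\<open>I i\<close> describes the state after the first \<open>i\<close> edges. Each edge
  adds two steps, for the counter and the test; the final 2 covers the initial store and the failing
  test.\<close>

lemma halts_for_edges:
  assumes "loop_free c"
    and frame: "\<And>s. run c s ''k'' = s ''k''" "\<And>s. run c s ''num_E'' = s ''num_E''"
    and m: "s ''num_E'' 0 = m"
    and init: "I 0 (s(''k'' := (s ''k'')(0 := 0)))"
    and step: "\<And>i s. i < m \<Longrightarrow> I i s \<Longrightarrow> s ''k'' 0 = i \<Longrightarrow>
      I (Suc i) ((run c s)(''k'' := (s ''k'')(0 := Suc i)))"
  shows "halts (for_edges c) s ((cost c + 2) * m + 2) (I m)"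
proof -
  let ?s = "s(''k'' := (s ''k'')(0 := 0))"
  let ?d = "Seq c (Store ''k'' (Lit 0) (Plus (scalar ''k'') (Lit 1)))"
  let ?b = "Less (scalar ''k'') (scalar ''num_E'')"
  let ?J = "\<lambda>s. s ''num_E'' 0 = m \<and> s ''k'' 0 \<le> m \<and> I (s ''k'' 0) s"
  let ?\<mu> = "\<lambda>s :: state. m - s ''k'' 0"
  have "halts (While ?b ?d) ?s (?\<mu> ?s * (cost ?d + 1) + 1) (\<lambda>s'. ?J s' \<and> \<not> bval ?b s')"
  proof (rule halts_While)
    show "?J ?s" using m init by simp
  next
    fix s assume J: "?J s" and b: "bval ?b s"
    then have "s ''k'' 0 < m" by simp
    then show "halts ?d s (cost ?d) (\<lambda>s'. ?J s' \<and> ?\<mu> s' < ?\<mu> s)"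
      using J step[of "s ''k'' 0" s] frame assms(1) by (intro halts_run) auto
  qed
  then have while: "halts (While ?b ?d) ?s ((cost c + 2) * m + 1) (I m)"
    by (rule halts_mono) (auto simp: le_antisym algebra_simps)
  have "halts (for_edges c) s
    (cost (Store ''k'' (Lit 0) (Lit 0)) + ((cost c + 2) * m + 1)) (I m)"
    unfolding for_edges_def by (rule halts_run_Seq) (use while in simp_all)
  then show ?thesis by (rule halts_mono) auto
qed

definition lev_at :: "vname \<Rightarrow> aexp" where
  "lev_at x = Acc ''lev'' (scalar x)"

definition m\<^sub>B_at :: "vname \<Rightarrow> aexp" where
  "m\<^sub>B_at x = Acc ''mB'' (Acc ''end_B'' (scalar x))"

text \<open>By truncated subtraction \<open>d - (d - 1)\<close> is 1 if the level exceeds the number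
  of B vertices and 0 otherwise, which expresses \<open>level_class\<close> without a
  conditional.\<close>

definition class_at :: "vname \<Rightarrow> aexp" where
  "class_at x = (let d = Minus (lev_at x) (scalar ''num_B'')
     in Minus (lev_at x) (Minus d (Minus d (Lit 1))))"

lemma aval_at [simp]:
  "aval (lev_at x) s = s ''lev'' (s x 0)"
  "aval (m\<^sub>B_at x) s = s ''mB'' (s ''end_B'' (s x 0))"
  "aval (class_at x) s = level_class (s ''num_B'' 0) (s ''lev'' (s x 0))"
  by (auto simp: lev_at_def m\<^sub>B_at_def class_at_def Let_def level_class_def)

text \<open>The first level of an edge to a critical \<open>b\<close> is 0, the initial content of
  memory, hence the \<open>Skip\<close>.\<close>

definition init_code :: com where
  "init_code = Seq
     (If (Less (Lit 0) (Acc ''crit_B'' (Acc ''end_B'' (scalar ''k'')))) Skip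
        (Store ''lev'' (scalar ''k'') (scalar ''num_B'')))
     (If (Less (Lit 0) (Acc ''crit_A'' (Acc ''end_A'' (scalar ''k''))))
        (Store ''last'' (scalar ''k'') (Plus (Plus (scalar ''num_B'') (Lit 1)) (scalar ''num_A'')))
        (Store ''last'' (scalar ''k'') (Plus (scalar ''num_B'') (Lit 1))))"

definition choose_code :: com where
  "choose_code = If
     (And (Eq (Acc ''mA'' (Acc ''end_A'' (scalar ''k''))) (Lit 0))
     (And (Not (Less (Acc ''last'' (scalar ''k'')) (lev_at ''k'')))
          (Or (Not (Less (scalar ''best'') (scalar ''num_E'')))
          (Or (Less (lev_at ''k'') (lev_at ''best''))
          (And (Eq (lev_at ''k'') (lev_at ''best''))
               (Or (Less (Acc ''rank_A'' (scalar ''k'')) (Acc ''rank_A'' (scalar ''best'')))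
               (And (Eq (Acc ''rank_A'' (scalar ''k'')) (Acc ''rank_A'' (scalar ''best'')))
               (And (Eq (m\<^sub>B_at ''k'') (Lit 0)) (Less (Lit 0) (m\<^sub>B_at ''best''))))))))))
     (Store ''best'' (Lit 0) (scalar ''k''))
     Skip"

definition alternative_code :: com where
  "alternative_code = If
     (And (Eq (Acc ''end_A'' (scalar ''k'')) (Acc ''end_A'' (scalar ''old'')))
     (And (Eq (m\<^sub>B_at ''k'') (Lit 0))
     (And (Eq (lev_at ''k'') (lev_at ''old''))
          (Eq (Acc ''rank_A'' (scalar ''k'')) (Acc ''rank_A'' (scalar ''old''))))))
     (Store ''alt'' (Lit 0) (scalar ''k''))
     Skip"

text \<open>The number of edges, which is no edge index, serves as the mark for "none
  found".\<close>

definition find_best :: com where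
  "find_best = Seq (Store ''best'' (Lit 0) (scalar ''num_E'')) (for_edges choose_code)"

text \<open>Subtracting 1 undoes the successor in \<open>mB\<close>. If the chosen \<open>b\<close>
  is free, the result 0 is meaningless, but \<open>propose\<close> tests for that case
  first.\<close>

definition find_alternative :: com where
  "find_alternative = Seq
     (Seq (Store ''old'' (Lit 0) (Minus (m\<^sub>B_at ''best'') (Lit 1)))
        (Store ''alt'' (Lit 0) (scalar ''num_E'')))
     (for_edges alternative_code)"

definition set_m\<^sub>A :: "vname \<Rightarrow> nat \<Rightarrow> com" where
  "set_m\<^sub>A x n = Store ''mA'' (Acc ''end_A'' (scalar x)) (Lit n)"

definition set_m\<^sub>B :: "vname \<Rightarrow> com" where
  "set_m\<^sub>B x = Store ''mB'' (Acc ''end_B'' (scalar x)) (Plus (scalar x) (Lit 1))"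

definition set_out :: "vname \<Rightarrow> nat \<Rightarrow> com" where
  "set_out x n = Store ''out'' (scalar x) (Lit n)"

definition raise :: "vname \<Rightarrow> com" where
  "raise x = Store ''lev'' (scalar x) (Plus (lev_at x) (Lit 1))"

text \<open>The four branches implement, in this order, \<open>match_free\<close>,
  \<open>rematch\<close>, \<open>reject\<close> and \<open>replace\<close>.\<close>

definition propose :: com where
  "propose =
     If (Eq (m\<^sub>B_at ''best'') (Lit 0))
       (Seq (set_m\<^sub>A ''best'' 1) (Seq (set_m\<^sub>B ''best'') (set_out ''best'' 1)))
    (If (Less (scalar ''alt'') (scalar ''num_E''))
       (Seq (set_m\<^sub>A ''best'' 1) (Seq (set_m\<^sub>B ''best'') (Seq (set_m\<^sub>B ''alt'')
         (Seq (set_out ''old'' 0) (Seq (set_out ''best'' 1) (set_out ''alt'' 1))))))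
    (If (Or (Less (class_at ''best'') (class_at ''old''))
        (And (Eq (class_at ''best'') (class_at ''old''))
             (Or (Less (Acc ''rank_B'' (scalar ''old'')) (Acc ''rank_B'' (scalar ''best'')))
             (And (Eq (Acc ''rank_B'' (scalar ''old'')) (Acc ''rank_B'' (scalar ''best'')))
                  (Not (Less (lev_at ''old'') (lev_at ''best'')))))))
       (raise ''best'')
       (Seq (raise ''old'') (Seq (set_m\<^sub>A ''old'' 0) (Seq (set_m\<^sub>A ''best'' 1)
         (Seq (set_m\<^sub>B ''best'') (Seq (set_out ''old'' 0) (set_out ''best'' 1))))))))"

definition critical_matching_program :: com where
  "critical_matching_program =
     Seq (for_edges init_code) (Seq find_best
       (While (Less (scalar ''best'') (scalar ''num_E''))
          (Seq find_alternative (Seq propose find_best))))"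

definition time_factor :: nat where
  "time_factor = cost init_code + 2 * cost choose_code + cost alternative_code + cost propose + 22"

text \<open>\<open>W\<close> bounds the number of rounds and is quadratic; a round is linear in the
  number \<open>n\<close> of edges. Additive constants are absorbed into multiples of
  \<open>N\<close>.\<close>

lemma time_estimate:
  fixes N n W a c i p :: nat
  assumes "n \<le> N" and "2 \<le> N" and "W \<le> N ^ 2"
  shows "((i + 2) * n + 2) + (((c + 2) * n + 3) +
      (W * (((a + 2) * n + 4) + (p + ((c + 2) * n + 3)) + 1) + 1))
    \<le> (i + 2 * c + a + p + 22) * N ^ 3"
proof -
  have lin: "x * n + y \<le> (x + y) * N" for x y
    unfolding add_mult_distrib using assms(1,2) by (intro add_mono) auto
  have "((a + 2) * n + 4) + (p + ((c + 2) * n + 3)) + 1 = (a + c + 4) * n + (p + 8)"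
    by (simp add: algebra_simps)
  also have "\<dots> \<le> (a + c + p + 12) * N" using lin[of "a + c + 4" "p + 8"] by (simp add: ac_simps)
  finally have "W * (((a + 2) * n + 4) + (p + ((c + 2) * n + 3)) + 1) \<le>
      N ^ 2 * ((a + c + p + 12) * N)"
    by (rule mult_le_mono[OF assms(3)])
  also have "\<dots> = (a + c + p + 12) * N ^ 3"
    by (simp add: power2_eq_square power3_eq_cube)
  finally have body: "W * (((a + 2) * n + 4) + (p + ((c + 2) * n + 3)) + 1) \<le> (a + c + p + 12) * N ^ 3" .
  have "((i + 2) * n + 2) + ((c + 2) * n + 3) + 1 = (i + c + 4) * n + 6"
    by (simp add: algebra_simps)
  also have "\<dots> \<le> (i + c + 10) * N" using lin[of "i + c + 4" 6] by (simp add: ac_simps)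
  also have "\<dots> \<le> (i + c + 10) * N ^ 3"
    using power_increasing[of 1 3 N] assms(2) by (intro mult_le_mono2) simp
  finally have "((i + 2) * n + 2) + ((c + 2) * n + 3) + 1 \<le> (i + c + 10) * N ^ 3" .
  moreover have "(i + 2 * c + a + p + 22) * N ^ 3 = (i + c + 10) * N ^ 3 + (a + c + p + 12) * N ^ 3"
    by (simp flip: add_mult_distrib)
  ultimately show ?thesis using body by linarith
qed

section \<open>The program maintains the invariant on every presentation of the input\<close>

locale presentation =
  fixes G :: "'v smti" and xs ys :: "'v list" and es :: "(nat \<times> nat) list"
  assumes valid: "valid_instance G" and presents: "presents xs ys es G"
begin

abbreviation "input \<equiv> input_state G xs ys es"

lemma input_simps [simp]:
  "input ''num_A'' 0 = length xs" "input ''num_B'' 0 = length ys" "input ''num_E'' 0 = length es"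
  "input ''lev'' = (\<lambda>_. 0)" "input ''mA'' = (\<lambda>_. 0)" "input ''mB'' = (\<lambda>_. 0)" "input ''out'' = (\<lambda>_. 0)"
  by (simp_all add: input_state_def)

sublocale edge_list "length xs" "length ys" "length es"
  "input ''end_A''" "input ''end_B''" "input ''rank_A''" "input ''rank_B''"
  "\<lambda>i. 0 < input ''crit_A'' i" "\<lambda>j. 0 < input ''crit_B'' j"
proof
  have es: "distinct es" "set es \<subseteq> {..<length xs} \<times> {..<length ys}"
    using presents by (auto simp: presents_def)
  fix k assume k: "k < length es"
  then have "es ! k \<in> {..<length xs} \<times> {..<length ys}" using es(2) nth_mem by blast
  then show "input ''end_A'' k < length xs" "input ''end_B'' k < length ys"
    using k by (auto simp: input_state_def mem_Times_iff)
  fix l assume "l < length es" "input ''end_A'' k = input ''end_A'' l"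
    "input ''end_B'' k = input ''end_B'' l"
  then show "k = l" using k es(1)
    by (auto simp: input_state_def prod_eq_iff nth_eq_iff_index_eq[symmetric])
qed

definition well_formed :: "state \<Rightarrow> bool" where
  "well_formed s \<longleftrightarrow>
     (\<forall>x\<in>{''num_A'', ''num_B'', ''num_E'', ''end_A'', ''end_B'', ''rank_A'', ''rank_B'',
        ''crit_A'', ''crit_B''}. s x = input x)"

definition state_inv :: "state \<Rightarrow> bool" where
  "state_inv s \<longleftrightarrow> well_formed s \<and> (\<forall>k<length es. s ''last'' k = lst_lev k) \<and>
     proposal_state (length xs) (length ys) (length es)
       (input ''end_A'') (input ''end_B'') (input ''rank_A'') (input ''rank_B'')
       (\<lambda>i. 0 < input ''crit_A'' i) (\<lambda>j. 0 < input ''crit_B'' j)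
       (s ''lev'') (s ''mA'') (s ''mB'') (s ''out'')"

lemma well_formed_simps:
  assumes "well_formed s"
  shows "s ''num_A'' = input ''num_A''" "s ''num_B'' = input ''num_B''"
    "s ''num_E'' = input ''num_E''" "s ''end_A'' = input ''end_A''" "s ''end_B'' = input ''end_B''"
    "s ''rank_A'' = input ''rank_A''" "s ''rank_B'' = input ''rank_B''"
    "s ''crit_A'' = input ''crit_A''" "s ''crit_B'' = input ''crit_B''"
  using assms by (simp_all add: well_formed_def)

lemma halts_init:
  "halts (for_edges init_code) input ((cost init_code + 2) * length es + 2) state_inv"
proof -
  let ?I = "\<lambda>i s. well_formed s \<and> s ''mA'' = (\<lambda>_. 0) \<and> s ''mB'' = (\<lambda>_. 0) \<and> s ''out'' = (\<lambda>_. 0) \<and>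
    (\<forall>l<length es. (l < i \<longrightarrow> s ''lev'' l = fst_lev l \<and> s ''last'' l = lst_lev l) \<and>
       (i \<le> l \<longrightarrow> s ''lev'' l = 0))"
  have "halts (for_edges init_code) input ((cost init_code + 2) * length es + 2) (?I (length es))"
  proof (rule halts_for_edges[where I = ?I])
    fix i s assume i: "i < length es" and I: "?I i s" and k: "s ''k'' 0 = i"
    have wf: "well_formed s" using I by simp
    show "?I (Suc i) ((run init_code s)(''k'' := (s ''k'')(0 := Suc i)))"
      using i I k well_formed_simps[OF wf]
      by (auto simp: init_code_def well_formed_def less_Suc_eq fst_lev_def lst_lev_def)
  qed (auto simp: init_code_def well_formed_def)
  then show ?thesis
  proof (rule halts_mono)
    fix s assume I: "?I (length es) s"
    then show "state_inv s"
      using proposal_state_init[of "s ''lev''"] by (auto simp: state_inv_def)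
  qed auto
qed

definition best_inv :: "state \<Rightarrow> bool" where
  "best_inv s \<longleftrightarrow>
     (if s ''best'' 0 < length es then chosen (s ''lev'') (s ''mA'') (s ''mB'') (s ''best'' 0)
      else \<forall>l<length es. \<not> candidate (s ''lev'') (s ''mA'') l)"

lemma state_inv_cong:
  assumes "state_inv s" and "\<And>x. x \<notin> {''k'', ''best'', ''old'', ''alt''} \<Longrightarrow> s' x = s x"
  shows "state_inv s'"
  using assms by (simp add: state_inv_def well_formed_def)

text \<open>\<open>lev\<close> and \<open>mB\<close> are recorded as unchanged because they
  determine the potential.\<close>

lemma halts_find_best:
  assumes "state_inv s"
  shows "halts find_best s ((cost choose_code + 2) * length es + 3)
    (\<lambda>s'. state_inv s' \<and> best_inv s' \<and> s' ''lev'' = s ''lev'' \<and> s' ''mB'' = s ''mB'')"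
proof -
  let ?s = "s(''best'' := (s ''best'')(0 := s ''num_E'' 0))"
  have wf: "well_formed s" using assms by (simp add: state_inv_def)
  have last: "\<And>k. k < length es \<Longrightarrow> s ''last'' k = lst_lev k" using assms by (simp add: state_inv_def)
  let ?cand = "candidate (s ''lev'') (s ''mA'')" and ?sooner = "sooner (s ''lev'') (s ''mB'')"
  let ?P = "\<lambda>i b. b = length es \<and> (\<forall>l<i. \<not> ?cand l) \<or>
    b < length es \<and> ?cand b \<and> (\<forall>l<i. ?cand l \<longrightarrow> \<not> ?sooner l b)"
  let ?I = "\<lambda>i s'. (\<forall>x. x \<notin> {''k'', ''best''} \<longrightarrow> s' x = s x) \<and> ?P i (s' ''best'' 0)"
  have "halts (for_edges choose_code) ?s ((cost choose_code + 2) * length es + 2) (?I (length es))"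
  proof (rule halts_for_edges[where I = ?I])
    fix i s' assume i: "i < length es" and I: "?I i s'" and k: "s' ''k'' 0 = i"
    let ?b = "s' ''best'' 0"
    have eq: "s' x = s x" if "x \<notin> {''k'', ''best''}" for x using I that by blast
    have run: "run choose_code s' = (if ?cand i \<and> (\<not> ?b < length es \<or> ?sooner i ?b)
        then s'(''best'' := (s' ''best'')(0 := i)) else s')"
      unfolding choose_code_def run.simps
      by (rule if_cong)
        (use last[OF i] in \<open>auto simp: eq k well_formed_simps[OF wf] candidate_def sooner_def\<close>)
    \<comment> \<open>Transitivity lets the scan keep a single edge: whatever is sooner than the new
      best edge would have been sooner than the old one.\<close>
    have trans: "?sooner l i \<Longrightarrow> ?sooner i ?b \<Longrightarrow> ?sooner l ?b" "\<not> ?sooner i i" for l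
      unfolding sooner_def by auto
    let ?s' = "(run choose_code s')(''k'' := (s' ''k'')(0 := Suc i))"
    let ?c = "?cand i \<and> (\<not> ?b < length es \<or> ?sooner i ?b)"
    have best: "?s' ''best'' 0 = (if ?c then i else ?b)" by (auto simp: run)
    have "?P (Suc i) (if ?c then i else ?b)"
    proof (cases ?c)
      case True
      moreover have "\<not> ?sooner l i" if "l < Suc i" "?cand l" for l
        using I True trans that less_antisym[of l i] by blast
      ultimately show ?thesis using i by simp
    next
      case False
      moreover have "?P i ?b" using I by blast
      ultimately have "?P (Suc i) ?b" unfolding less_Suc_eq by auto
      then show ?thesis unfolding if_not_P[OF False] .
    qed
    then have "?P (Suc i) (?s' ''best'' 0)" unfolding best .
    moreover have "\<forall>x. x \<notin> {''k'', ''best''} \<longrightarrow> ?s' x = s x" by (simp add: run eq)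
    ultimately show "?I (Suc i) ?s'" by (rule conjI[rotated])
  qed (auto simp: choose_code_def well_formed_simps[OF wf])
  then have "halts find_best s (cost (Store ''best'' (Lit 0) (scalar ''num_E'')) +
      ((cost choose_code + 2) * length es + 2)) (?I (length es))"
    unfolding find_best_def by (intro halts_run_Seq) simp_all
  then show ?thesis
  proof (rule halts_mono)
    fix s' assume I: "?I (length es) s'"
    then have eq: "s' x = s x" if "x \<notin> {''k'', ''best''}" for x using that by blast
    have P: "?P (length es) (s' ''best'' 0)" using I by blast
    have "state_inv s'" by (rule state_inv_cong[OF assms]) (simp add: eq)
    moreover have "best_inv s'"
      using P by (elim disjE) (simp_all add: best_inv_def chosen_def eq)
    ultimately show "state_inv s' \<and> best_inv s' \<and> s' ''lev'' = s ''lev'' \<and> s' ''mB'' = s ''mB''"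
      by (simp add: eq)
  qed auto
qed

definition alternative_inv :: "state \<Rightarrow> bool" where
  "alternative_inv s \<longleftrightarrow> s ''old'' 0 = s ''mB'' (input ''end_B'' (s ''best'' 0)) - 1 \<and>
     (if s ''alt'' 0 < length es then alternative (s ''lev'') (s ''mB'') (s ''old'' 0) (s ''alt'' 0)
      else \<forall>l<length es. \<not> alternative (s ''lev'') (s ''mB'') (s ''old'' 0) l)"

lemma halts_find_alternative:
  assumes "state_inv s" and "best_inv s"
  shows "halts find_alternative s ((cost alternative_code + 2) * length es + 4)
    (\<lambda>s'. state_inv s' \<and> best_inv s' \<and> alternative_inv s' \<and>
       s' ''lev'' = s ''lev'' \<and> s' ''mB'' = s ''mB'' \<and> s' ''best'' = s ''best'')"
proof -
  let ?c = "Seq (Store ''old'' (Lit 0) (Minus (m\<^sub>B_at ''best'') (Lit 1)))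
      (Store ''alt'' (Lit 0) (scalar ''num_E''))"
  let ?s = "run ?c s"
  have wf: "well_formed s" using assms by (simp add: state_inv_def)
  define f where "f = s ''mB'' (input ''end_B'' (s ''best'' 0)) - 1"
  let ?alt = "alternative (s ''lev'') (s ''mB'') f"
  let ?I = "\<lambda>i s'. (\<forall>x. x \<notin> {''k'', ''old'', ''alt''} \<longrightarrow> s' x = s x) \<and> s' ''old'' 0 = f \<and>
    (s' ''alt'' 0 = length es \<and> (\<forall>l<i. \<not> ?alt l) \<or> s' ''alt'' 0 < length es \<and> ?alt (s' ''alt'' 0))"
  have "halts (for_edges alternative_code) ?s ((cost alternative_code + 2) * length es + 2)
    (?I (length es))"
  proof (rule halts_for_edges[where I = ?I])
    fix i s' assume i: "i < length es" and I: "?I i s'" and k: "s' ''k'' 0 = i"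
    have eq: "s' x = s x" if "x \<notin> {''k'', ''old'', ''alt''}" for x using I that by blast
    have run: "run alternative_code s' =
        (if ?alt i then s'(''alt'' := (s' ''alt'')(0 := i)) else s')"
      using I by (simp add: alternative_code_def eq k well_formed_simps[OF wf] alternative_def)
    show "?I (Suc i) ((run alternative_code s')(''k'' := (s' ''k'')(0 := Suc i)))"
      using I i by (cases "?alt i") (auto simp: run less_Suc_eq)
  qed (auto simp: alternative_code_def well_formed_simps[OF wf] f_def)
  then have "halts find_alternative s (cost ?c +
      ((cost alternative_code + 2) * length es + 2)) (?I (length es))"
    unfolding find_alternative_def by (intro halts_run_Seq) simp_all
  then show ?thesis
  proof (rule halts_mono)
    fix s' assume I: "?I (length es) s'"
    then have eq: "s' x = s x" if "x \<notin> {''k'', ''old'', ''alt''}" for x using that by blast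
    have "state_inv s'" by (rule state_inv_cong[OF assms(1)]) (simp add: eq)
    moreover have "best_inv s'" using assms(2) by (simp add: best_inv_def eq)
    moreover have "s' ''old'' 0 = f" and
      "s' ''alt'' 0 = length es \<and> (\<forall>l<length es. \<not> ?alt l) \<or>
       s' ''alt'' 0 < length es \<and> ?alt (s' ''alt'' 0)"
      using I by blast+
    then have "alternative_inv s'"
      by (elim disjE) (simp_all add: alternative_inv_def eq f_def)
    ultimately show "state_inv s' \<and> best_inv s' \<and> alternative_inv s' \<and>
       s' ''lev'' = s ''lev'' \<and> s' ''mB'' = s ''mB'' \<and> s' ''best'' = s ''best''"
      by (simp add: eq)
  qed auto
qed

lemma halts_propose:
  assumes inv: "state_inv s" "best_inv s" "alternative_inv s" and best: "s ''best'' 0 < length es"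
  shows "halts propose s (cost propose) (\<lambda>s'. state_inv s' \<and>
    potential (s' ''lev'') (s' ''mB'') < potential (s ''lev'') (s ''mB''))"
proof (rule halts_run)
  show "loop_free propose"
    by (simp add: propose_def set_m\<^sub>A_def set_m\<^sub>B_def set_out_def raise_def)
  let ?k = "s ''best'' 0" and ?f = "s ''old'' 0" and ?l = "s ''alt'' 0"
  let ?L = "s ''lev''" and ?A = "s ''mA''" and ?B = "s ''mB''" and ?O = "s ''out''"
  let ?a = "input ''end_A''" and ?b = "input ''end_B''"
  interpret proposal_state "length xs" "length ys" "length es"
    ?a ?b "input ''rank_A''" "input ''rank_B''"
    "\<lambda>i. 0 < input ''crit_A'' i" "\<lambda>j. 0 < input ''crit_B'' j" ?L ?A ?B ?O
    using inv(1) by (simp add: state_inv_def)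
  have wf: "well_formed s" using inv(1) by (simp add: state_inv_def)
  have last: "\<And>k. k < length es \<Longrightarrow> s ''last'' k = lst_lev k" using inv(1) by (simp add: state_inv_def)
  have chosen: "chosen ?L ?A ?B ?k" using inv(2) best by (simp add: best_inv_def)
  have code_simps: "run (set_m\<^sub>A x n) s' = s'(''mA'' := (s' ''mA'')(s' ''end_A'' (s' x 0) := n))"
    "run (set_m\<^sub>B x) s' = s'(''mB'' := (s' ''mB'')(s' ''end_B'' (s' x 0) := Suc (s' x 0)))"
    "run (set_out x n) s' = s'(''out'' := (s' ''out'')(s' x 0 := n))"
    "run (raise x) s' = s'(''lev'' := (s' ''lev'')(s' x 0 := Suc (s' ''lev'' (s' x 0))))" for x n s'
    by (simp_all add: set_m\<^sub>A_def set_m\<^sub>B_def set_out_def raise_def)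
  have goal: "state_inv s' \<and> potential (s' ''lev'') (s' ''mB'') < potential ?L ?B"
    if "s' = s(''lev'' := L, ''mA'' := A, ''mB'' := B, ''out'' := F)"
      "proposal_state (length xs) (length ys) (length es) ?a ?b (input ''rank_A'') (input ''rank_B'')
        (\<lambda>i. 0 < input ''crit_A'' i) (\<lambda>j. 0 < input ''crit_B'' j) L A B F"
      "potential L B < potential ?L ?B" for s' L A B F
    using that wf last by (simp add: state_inv_def well_formed_def)
  consider (free) "?B (?b ?k) = 0"
    | (swap) "?B (?b ?k) = Suc ?f" "?l < length es" "alternative ?L ?B ?f ?l"
    | (settled) "?B (?b ?k) = Suc ?f" "\<not> ?l < length es" "\<And>l. l < length es \<Longrightarrow> \<not> alternative ?L ?B ?f l"
    using inv(3) unfolding alternative_inv_def by (cases "?B (?b ?k)") (auto split: if_splits)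
  then show "state_inv (run propose s) \<and>
    potential (run propose s ''lev'') (run propose s ''mB'') < potential ?L ?B"
  proof cases
    case free
    show ?thesis
      by (rule goal[OF _ match_free[OF chosen free]])
        (use free in \<open>auto simp: propose_def code_simps well_formed_simps[OF wf] fun_eq_iff\<close>)
  next
    case swap
    show ?thesis
      by (rule goal[OF _ rematch[OF chosen swap]])
        (use swap in \<open>auto simp: propose_def code_simps well_formed_simps[OF wf] fun_eq_iff\<close>)
  next
    case settled
    let ?offer = "offer_le (length ys) (?L ?k) (input ''rank_B'' ?k) (?L ?f) (input ''rank_B'' ?f)"
    have run: "run propose s = (if ?offer then run (raise ''best'') s
      else run (Seq (raise ''old'') (Seq (set_m\<^sub>A ''old'' 0) (Seq (set_m\<^sub>A ''best'' 1)
         (Seq (set_m\<^sub>B ''best'') (Seq (set_out ''old'' 0) (set_out ''best'' 1)))))) s)"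
      using settled(1,2)
      by (auto simp: propose_def well_formed_simps[OF wf] offer_le_def simp del: run.simps(3))
    show ?thesis
    proof (cases ?offer)
      case True
      show ?thesis
        by (rule goal[OF _ reject[OF chosen settled(1,3) True]])
          (use True in \<open>auto simp: run code_simps fun_eq_iff\<close>)
    next
      case False
      show ?thesis
        by (rule goal[OF _ replace[OF chosen settled(1,3) False]])
          (use False in \<open>auto simp: run code_simps well_formed_simps[OF wf] fun_eq_iff\<close>)
    qed
  qed
qed

lemma potential_bound:
  "potential lev m\<^sub>B \<le> length es * (length xs + length ys + 2) + length ys"
proof -
  have "(\<Sum>k<length es. lst_lev k + 1 - lev k) \<le> (\<Sum>k<length es. length xs + length ys + 2)"
    by (rule sum_mono) (auto simp: lst_lev_def)
  moreover have "card {j. j < length ys \<and> m\<^sub>B j = 0} \<le> card {..<length ys}"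
    by (rule card_mono) auto
  ultimately show ?thesis by (simp add: potential_def)
qed

lemma halts_program:
  "halts critical_matching_program input (time_factor * (length xs + length ys + length es + 2) ^ 3)
    (\<lambda>s. state_inv s \<and> (\<forall>l<length es. \<not> candidate (s ''lev'') (s ''mA'') l))"
proof -
  let ?n = "length es" and ?N = "length xs + length ys + length es + 2"
  let ?b = "Less (scalar ''best'') (scalar ''num_E'')"
  let ?c = "Seq find_alternative (Seq propose find_best)"
  let ?J = "\<lambda>s. state_inv s \<and> best_inv s"
  let ?\<mu> = "\<lambda>s :: state. potential (s ''lev'') (s ''mB'')"
  let ?T = "((cost alternative_code + 2) * ?n + 4) + (cost propose + ((cost choose_code + 2) * ?n + 3))"
  let ?W = "length es * (length xs + length ys + 2) + length ys"
  have body: "halts ?c s ?T (\<lambda>s'. ?J s' \<and> ?\<mu> s' < ?\<mu> s)" if J: "?J s" and b: "bval ?b s" for s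
  proof -
    have best: "s ''best'' 0 < length es"
      using J b by (auto simp: state_inv_def well_formed_simps)
    show ?thesis
    proof (rule halts_Seq)
      show "halts find_alternative s ((cost alternative_code + 2) * ?n + 4)
        (\<lambda>s'. state_inv s' \<and> best_inv s' \<and> alternative_inv s' \<and>
           s' ''lev'' = s ''lev'' \<and> s' ''mB'' = s ''mB'' \<and> s' ''best'' = s ''best'')"
        using J by (intro halts_find_alternative) auto
      fix s' assume s': "state_inv s' \<and> best_inv s' \<and> alternative_inv s' \<and>
           s' ''lev'' = s ''lev'' \<and> s' ''mB'' = s ''mB'' \<and> s' ''best'' = s ''best''"
      show "halts (Seq propose find_best) s' (cost propose + ((cost choose_code + 2) * ?n + 3))
        (\<lambda>s''. ?J s'' \<and> ?\<mu> s'' < ?\<mu> s)"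
      proof (rule halts_Seq)
        show "halts propose s' (cost propose) (\<lambda>s''. state_inv s'' \<and> ?\<mu> s'' < ?\<mu> s')"
          using s' best by (intro halts_propose) auto
        fix s'' assume "state_inv s'' \<and> ?\<mu> s'' < ?\<mu> s'"
        then show "halts find_best s'' ((cost choose_code + 2) * ?n + 3)
            (\<lambda>s''. ?J s'' \<and> ?\<mu> s'' < ?\<mu> s)"
          using s' by (auto intro: halts_mono[OF halts_find_best])
      qed
    qed
  qed
  have while: "halts (While ?b ?c) s (?W * (?T + 1) + 1)
      (\<lambda>s. state_inv s \<and> (\<forall>l<length es. \<not> candidate (s ''lev'') (s ''mA'') l))" if "?J s" for s
  proof (rule halts_mono[OF halts_While[of ?J s ?b ?c ?T ?\<mu>, OF that body]])
    show "?\<mu> s * (?T + 1) + 1 \<le> ?W * (?T + 1) + 1"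
      by (intro add_right_mono mult_right_mono potential_bound) simp
    \<comment> \<open>At loop exit no edge was found, so the second branch of
      \<open>best_inv\<close> applies.\<close>
    fix s' assume "?J s' \<and> \<not> bval ?b s'"
    then show "state_inv s' \<and> (\<forall>l<length es. \<not> candidate (s' ''lev'') (s' ''mA'') l)"
      by (auto simp: state_inv_def best_inv_def well_formed_simps)
  qed
  have "halts critical_matching_program input (((cost init_code + 2) * ?n + 2) +
      (((cost choose_code + 2) * ?n + 3) + (?W * (?T + 1) + 1)))
    (\<lambda>s. state_inv s \<and> (\<forall>l<length es. \<not> candidate (s ''lev'') (s ''mA'') l))"
    unfolding critical_matching_program_def
    by (intro halts_Seq[OF halts_init] halts_Seq[OF halts_find_best] while) auto
  moreover have "((cost init_code + 2) * ?n + 2) +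
      (((cost choose_code + 2) * ?n + 3) + (?W * (?T + 1) + 1)) \<le> time_factor * ?N ^ 3"
    unfolding time_factor_def
    by (rule time_estimate) (simp_all add: power2_eq_square algebra_simps)
  ultimately show ?thesis by (rule halts_mono)
qed

end

section \<open>Correctness of the output\<close>

context presentation
begin

section \<open>Translation from edge indices back to vertices, and the final result\<close>

definition edge :: "nat \<Rightarrow> 'v \<times> 'v" where
  "edge k = (xs ! fst (es ! k), ys ! snd (es ! k))"

definition index :: "'v \<Rightarrow> 'v \<Rightarrow> nat" where
  "index a b = inv_into {..<length es} edge (a, b)"

lemma lists: "distinct xs" "distinct ys" "set xs = side_A G" "set ys = side_B G"
  "length xs = card (side_A G)" "length ys = card (side_B G)"
  using presents unfolding presents_def by (auto simp: distinct_card[symmetric])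

lemma end_input: "k < length es \<Longrightarrow> input ''end_A'' k = fst (es ! k)"
    "k < length es \<Longrightarrow> input ''end_B'' k = snd (es ! k)"
  by (simp_all add: input_state_def)

lemma end_bounds:
  assumes "k < length es"
  shows "fst (es ! k) < length xs" and "snd (es ! k) < length ys"
  using end_less[OF assms] end_input[OF assms] by auto

lemma edge_ends_eq_iff:
  assumes "k < length es" and "l < length es"
  shows "fst (edge k) = fst (edge l) \<longleftrightarrow> input ''end_A'' k = input ''end_A'' l"
    and "snd (edge k) = snd (edge l) \<longleftrightarrow> input ''end_B'' k = input ''end_B'' l"
  using assms end_bounds lists(1,2) by (auto simp: edge_def end_input nth_eq_iff_index_eq)

lemma edges_eq: "edges G = edge ` {..<length es}"
proof -
  have "edges G = (\<lambda>(i, j). (xs ! i, ys ! j)) ` set es" using presents by (simp add: presents_def)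
  also have "set es = (!) es ` {..<length es}" by (auto simp: set_conv_nth)
  finally show ?thesis by (auto simp: edge_def image_image case_prod_beta)
qed

lemma edge_inj: "inj_on edge {..<length es}"
  using edge_ends_eq_iff end_inj by (auto intro!: inj_onI simp: prod_eq_iff)

lemma card_edges: "card (edges G) = length es"
  unfolding edges_eq using edge_inj by (simp add: card_image)

lemma index_edge: "k < length es \<Longrightarrow> edge k = (a, b) \<Longrightarrow> index a b = k"
  unfolding index_def using inv_into_f_f[OF edge_inj, of k] by simp

lemma edge_levels:
  assumes "k < length es" and "edge k = (a, b)"
  shows "first_level G b = fst_lev k" and "last_level G a = lst_lev k"
    and "rank G a b = input ''rank_A'' k" and "rank G b a = input ''rank_B'' k"
  unfolding first_level_def last_level_def fst_lev_def lst_lev_def lists(5,6)[symmetric]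
  using assms end_bounds[OF assms(1)] by (auto simp: edge_def input_state_def)

text \<open>The invariant is carried over along \<open>edge\<close>. Termination supplies
  \<open>exhausted\<close>: if the proposer is unmatched, its edges fail to be candidates only by
  having passed their last level.\<close>

lemma proposal_outcome:
  assumes "state_inv s" and finished: "\<forall>l<length es. \<not> candidate (s ''lev'') (s ''mA'') l"
  shows "proposal_outcome G (output_edges xs ys es s) (\<lambda>a b. s ''lev'' (index a b))"
proof -
  let ?a = "input ''end_A''" and ?b = "input ''end_B''"
  let ?L = "s ''lev''" and ?A = "s ''mA''" and ?B = "s ''mB''"
  interpret st: proposal_state "length xs" "length ys" "length es"
    ?a ?b "input ''rank_A''" "input ''rank_B''"
    "\<lambda>i. 0 < input ''crit_A'' i" "\<lambda>j. 0 < input ''crit_B'' j" ?L ?A ?B "s ''out''"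
    using assms(1) by (simp add: state_inv_def)
  define M where "M = edge ` {k. in_M ?B k}"
  have M: "output_edges xs ys es s = M"
    using st.out_iff unfolding output_edges_def M_def edge_def by (auto simp: in_M_def)
  have in_M_less: "in_M ?B k \<Longrightarrow> k < length es" for k by (simp add: in_M_def)
  have sides: "side_A G \<inter> side_B G = {}" using valid by (simp add: valid_instance_def)
  have edge_sides: "fst (edge k) \<in> side_A G" "snd (edge k) \<in> side_B G" if "k < length es" for k
    using end_bounds[OF that] lists(3,4) by (auto simp: edge_def)
  \<comment> \<open>On side B this holds because the array stores one edge per vertex, on side A by
    the clause \<open>in_M_inj\<close>.\<close>
  have disj: "k = l" if "in_M ?B k" "in_M ?B l"
    "fst (edge k) = fst (edge l) \<or> snd (edge k) = snd (edge l)" for k l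
  proof -
    have "?a k = ?a l \<or> ?b k = ?b l"
      using that(3) edge_ends_eq_iff[OF in_M_less[OF that(1)] in_M_less[OF that(2)]] by blast
    moreover have "k = l" if "?b k = ?b l"
      using \<open>in_M ?B k\<close> \<open>in_M ?B l\<close> that unfolding in_M_def by (metis nat.inject)
    ultimately show ?thesis using st.in_M_inj[OF that(1,2)] by blast
  qed
  have matching: "matching G M"
    unfolding matching_def
  proof (intro conjI ballI impI)
    show "M \<subseteq> edges G" using in_M_less unfolding M_def edges_eq by auto
    fix e f assume "e \<in> M" "f \<in> M" "e \<noteq> f"
    then obtain k l where kl: "in_M ?B k" "in_M ?B l" "e = edge k" "f = edge l" "k \<noteq> l"
      unfolding M_def by auto
    then have "fst e \<noteq> fst f" "snd e \<noteq> snd f" using disj by blast+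
    moreover have "fst e \<noteq> snd f" "snd e \<noteq> fst f"
      using kl edge_sides in_M_less sides by (metis disjoint_iff)+
    ultimately show "{fst e, snd e} \<inter> {fst f, snd f} = {}" by auto
  qed
  have matched_A: "matched M a \<longleftrightarrow> ?A (?a k) \<noteq> 0" if "k < length es" "edge k = (a, b)" for a b k
  proof -
    have "a \<in> side_A G" using edge_sides(1)[OF that(1)] that(2) by simp
    then have "matched M a \<longleftrightarrow> (\<exists>l. in_M ?B l \<and> fst (edge l) = fst (edge k))"
      using matched_side(1)[OF valid matching] that(2) unfolding M_def
      by (auto simp: image_iff prod_eq_iff)
    also have "\<dots> \<longleftrightarrow> (\<exists>l. in_M ?B l \<and> ?a l = ?a k)"
      using edge_ends_eq_iff(1)[OF in_M_less that(1)] by blast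
    also have "\<dots> \<longleftrightarrow> ?A (?a k) \<noteq> 0" using st.m\<^sub>A_in_M st.in_M_m\<^sub>A by metis
    finally show ?thesis .
  qed
  have matched_B: "matched M b \<longleftrightarrow> ?B (?b k) \<noteq> 0" if "k < length es" "edge k = (a, b)" for a b k
  proof -
    have "b \<in> side_B G" using edge_sides(2)[OF that(1)] that(2) by simp
    then have "matched M b \<longleftrightarrow> (\<exists>l. in_M ?B l \<and> snd (edge l) = snd (edge k))"
      using matched_side(2)[OF valid matching] that(2) unfolding M_def
      by (auto simp: image_iff prod_eq_iff)
    also have "\<dots> \<longleftrightarrow> (\<exists>l. in_M ?B l \<and> ?b l = ?b k)"
      using edge_ends_eq_iff(2)[OF in_M_less that(1)] by blast
    also have "\<dots> \<longleftrightarrow> ?B (?b k) \<noteq> 0"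
    proof
      assume "?B (?b k) \<noteq> 0"
      then obtain f where "?B (?b k) = Suc f" using not0_implies_Suc by blast
      then show "\<exists>l. in_M ?B l \<and> ?b l = ?b k" using st.in_M_partner by blast
    next
      assume "\<exists>l. in_M ?B l \<and> ?b l = ?b k"
      then show "?B (?b k) \<noteq> 0" unfolding in_M_def by (metis nat.distinct(1))
    qed
    finally show ?thesis .
  qed
  have edgeE: "\<exists>k<length es. edge k = (a, b) \<and> index a b = k" if ab: "(a, b) \<in> edges G" for a b
  proof -
    obtain k where "k < length es" "edge k = (a, b)" using ab unfolding edges_eq by force
    then show ?thesis using index_edge by blast
  qed
  have ME: "\<exists>k. in_M ?B k \<and> k < length es \<and> edge k = (a, b) \<and> index a b = k" if ab: "(a, b) \<in> M" for a b
  proof -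
    obtain k where "in_M ?B k" "edge k = (a, b)" using ab unfolding M_def by force
    then show ?thesis using index_edge in_M_less by blast
  qed
  have same_A: "?a k = ?a l" if "k < length es" "l < length es" "edge k = (a, b)" "edge l = (a, b')"
    for k l a b b' using edge_ends_eq_iff(1)[OF that(1,2)] that by simp
  have same_B: "?b k = ?b l" if "k < length es" "l < length es" "edge k = (a, b)" "edge l = (a', b)"
    for k l a a' b using edge_ends_eq_iff(2)[OF that(1,2)] that by simp
  show ?thesis
    unfolding M
  proof
    show "valid_instance G" by (rule valid)
    show "matching G M" by (rule matching)
  next
    fix a b assume "(a, b) \<in> edges G"
    then show "first_level G b \<le> ?L (index a b)"
      using edgeE edge_levels st.lev_ge by metis
  next
    fix a b assume "(a, b) \<in> M"
    then show "?L (index a b) \<le> last_level G a"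
      using ME edge_levels(2) st.in_M_lev by metis
  next
    fix a b b' assume "(a, b) \<in> M" "(a, b') \<in> edges G"
    then obtain k l where k: "in_M ?B k" "k < length es" "edge k = (a, b)" "index a b = k"
      and l: "l < length es" "edge l = (a, b')" "index a b' = l" using ME edgeE by metis
    then show "?L (index a b) < ?L (index a b') \<or>
        ?L (index a b) = ?L (index a b') \<and> rank G a b \<le> rank G a b'"
      using st.in_M_best[OF k(1) l(1)] same_A[OF l(1) k(2) l(2) k(3)] edge_levels(3) by auto
  next
    fix a b assume e: "(a, b) \<in> edges G" and raised: "first_level G b < ?L (index a b)"
    then obtain k where k: "k < length es" "edge k = (a, b)" "index a b = k" using edgeE by metis
    then obtain f where f: "?B (?b k) = Suc f" "offer_le (length ys) (?L k - 1) (input ''rank_B'' k)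
        (?L f) (input ''rank_B'' f)"
      using st.raised[OF k(1)] raised edge_levels(1)[OF k(1,2)] by auto
    have fM: "in_M ?B f" "f < length es" "?b f = ?b k"
      using st.in_M_partner[OF f(1)] by (auto simp: in_M_def)
    then have "snd (edge f) = b" using edge_ends_eq_iff(2)[OF fM(2) k(1)] k(2) by simp
    then obtain a' where a': "edge f = (a', b)" by (metis prod.collapse)
    have "(a', b) \<in> M" using fM(1) a' unfolding M_def by (metis imageI mem_Collect_eq)
    then show "\<exists>a'. (a', b) \<in> M \<and> offer_le (card (side_B G)) (?L (index a b) - 1) (rank G b a)
        (?L (index a' b)) (rank G b a')"
      using f(2) k(3) index_edge[OF fM(2) a'] edge_levels(4)[OF k(1,2)] edge_levels(4)[OF fM(2) a']
        lists(6) by auto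
  next
    fix a b assume e: "(a, b) \<in> edges G" and "\<not> matched M a"
    then obtain k where k: "k < length es" "edge k = (a, b)" "index a b = k" using edgeE by metis
    then show "last_level G a < ?L (index a b)"
      using finished matched_A[OF k(1,2)] \<open>\<not> matched M a\<close> edge_levels(2)[OF k(1,2)]
      by (auto simp: candidate_def)
  next
    fix a b b\<^sub>0 a' assume "(a, b) \<in> M" "(a, b\<^sub>0) \<in> edges G" "\<not> matched M b\<^sub>0"
      and tie: "?L (index a b\<^sub>0) = ?L (index a b)" "rank G a b\<^sub>0 = rank G a b" and "(a', b) \<in> edges G"
    then obtain k l e where k: "in_M ?B k" "k < length es" "edge k = (a, b)" "index a b = k"
      and l: "l < length es" "edge l = (a, b\<^sub>0)" "index a b\<^sub>0 = l"
      and e: "e < length es" "edge e = (a', b)" "index a' b = e"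
      using ME edgeE by metis
    have "alternative ?L ?B k l"
      using tie k(4) l(3) same_A[OF l(1) k(2) l(2) k(3)] matched_B[OF l(1,2)] \<open>\<not> matched M b\<^sub>0\<close>
        edge_levels(3)[OF k(2,3)] edge_levels(3)[OF l(1,2)]
      by (simp add: alternative_def)
    then have "?L e = fst_lev e"
      using st.unsettled[OF k(1) l(1) _ e(1)] same_B[OF e(1) k(2) e(2) k(3)] by simp
    then show "?L (index a' b) = first_level G b"
      using e(3) edge_levels(1)[OF e(1,2)] by simp
  qed
qed

lemma computes:
  "\<exists>t s. exec critical_matching_program input t s \<and>
     t \<le> time_factor * (card (side_A G) + card (side_B G) + card (edges G) + 2) ^ 3 \<and>
     critical_relaxed_stable_matching G (output_edges xs ys es s) \<and>
     (\<forall>N. matching G N \<and> relaxed_stable G N \<longrightarrow> 2 * card N \<le> 3 * card (output_edges xs ys es s))"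
proof -
  obtain t s where s: "exec critical_matching_program input t s"
    "t \<le> time_factor * (length xs + length ys + length es + 2) ^ 3" "state_inv s"
    "\<forall>l<length es. \<not> candidate (s ''lev'') (s ''mA'') l"
    using halts_program unfolding halts_def by blast
  interpret out: proposal_outcome G "output_edges xs ys es s" "\<lambda>a b. s ''lev'' (index a b)"
    by (rule proposal_outcome[OF s(3,4)])
  show ?thesis
    using s(1,2) out.matching out.critical out.relaxed_stable out.two_thirds lists(5,6) card_edges
    unfolding critical_relaxed_stable_matching_def by auto
qed

end

text \<open>The existence half of the theorem mentions no presentation, yet its matching is obtained
  by running the program on one.\<close>

lemma presentation_exists:
  assumes "valid_instance G"
  obtains xs ys es where "presents xs ys es G"
proof -
  have fin: "finite (side_A G)" "finite (side_B G)" and sub: "edges G \<subseteq> side_A G \<times> side_B G"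
    using assms by (auto simp: valid_instance_def)
  obtain xs where xs: "set xs = side_A G" "distinct xs" using finite_distinct_list[OF fin(1)] by blast
  obtain ys where ys: "set ys = side_B G" "distinct ys" using finite_distinct_list[OF fin(2)] by blast
  let ?I = "{p \<in> {..<length xs} \<times> {..<length ys}. (xs ! fst p, ys ! snd p) \<in> edges G}"
  have "finite ?I" by simp
  then obtain es where es: "set es = ?I" "distinct es" using finite_distinct_list by blast
  have "(\<lambda>(i, j). (xs ! i, ys ! j)) ` set es = edges G"
  proof
    show "edges G \<subseteq> (\<lambda>(i, j). (xs ! i, ys ! j)) ` set es"
    proof
      fix e assume e: "e \<in> edges G"
      then have "fst e \<in> set xs" "snd e \<in> set ys" using sub xs(1) ys(1) by auto
      then obtain i j where "i < length xs" "xs ! i = fst e" "j < length ys" "ys ! j = snd e"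
        by (meson in_set_conv_nth)
      then have "(i, j) \<in> set es" "e = (xs ! i, ys ! j)" using e es(1) by auto
      then show "e \<in> (\<lambda>(i, j). (xs ! i, ys ! j)) ` set es" by force
    qed
    show "(\<lambda>(i, j). (xs ! i, ys ! j)) ` set es \<subseteq> edges G" unfolding es(1) by clarsimp
  qed
  moreover have "set es \<subseteq> {..<length xs} \<times> {..<length ys}" unfolding es(1) by blast
  ultimately have "presents xs ys es G" using xs ys es(2) unfolding presents_def by blast
  then show thesis by (rule that)
qed

theorem theorem1:
  shows "(\<forall>G :: 'v smti. valid_instance G \<longrightarrow>
            (\<exists>M. critical_relaxed_stable_matching G M)) \<and>
         (\<exists>P p. \<forall>G :: 'v smti. valid_instance G \<longrightarrow>
            computes_in_time P p G
              (\<lambda>M. critical_relaxed_stable_matching G M \<and>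
                   (\<forall>M'. max_critical_relaxed_stable_matching G M' \<longrightarrow>
                      real (card M) \<ge> 2 / 3 * real (card M'))))"
proof (intro conjI allI impI)
  fix G :: "'v smti" assume G: "valid_instance G"
  then obtain xs ys es where "presents xs ys es G" by (rule presentation_exists)
  with G interpret presentation G xs ys es by unfold_locales
  show "\<exists>M. critical_relaxed_stable_matching G M" using computes by blast
next
  \<comment> \<open>\<open>[:2, 1:]\<close> is the polynomial x + 2, so this is the cubic bound of
    \<open>halts_program\<close> in the input size.\<close>
  let ?p = "smult time_factor ([:2, 1:] ^ 3)"
  have "computes_in_time critical_matching_program ?p G
      (\<lambda>M. critical_relaxed_stable_matching G M \<and>
           (\<forall>M'. max_critical_relaxed_stable_matching G M' \<longrightarrow>
              real (card M) \<ge> 2 / 3 * real (card M')))"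
    if G: "valid_instance G" for G :: "'v smti"
    unfolding computes_in_time_def
  proof (intro allI impI)
    fix xs ys es assume "presents xs ys es G"
    with G interpret presentation G xs ys es by unfold_locales
    obtain t s where s: "exec critical_matching_program input t s"
      "t \<le> time_factor * (card (side_A G) + card (side_B G) + card (edges G) + 2) ^ 3"
      "critical_relaxed_stable_matching G (output_edges xs ys es s)"
      and card: "\<And>N. matching G N \<Longrightarrow> relaxed_stable G N \<Longrightarrow>
        2 * card N \<le> 3 * card (output_edges xs ys es s)"
      using computes by blast
    have "2 / 3 * real (card M') \<le> real (card (output_edges xs ys es s))"
      if "max_critical_relaxed_stable_matching G M'" for M'
      using card[of M'] that
      unfolding max_critical_relaxed_stable_matching_def critical_relaxed_stable_matching_def
      by linarith
    moreover have "poly ?p n = time_factor * (n + 2) ^ 3" for n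
      by (simp add: add.commute)
    ultimately show "\<exists>t s. exec critical_matching_program input t s \<and>
        t \<le> poly ?p (card (side_A G) + card (side_B G) + card (edges G)) \<and>
        critical_relaxed_stable_matching G (output_edges xs ys es s) \<and>
        (\<forall>M'. max_critical_relaxed_stable_matching G M' \<longrightarrow>
          2 / 3 * real (card M') \<le> real (card (output_edges xs ys es s)))"
      using s by metis
  qed
  then show "\<exists>P p. \<forall>G :: 'v smti. valid_instance G \<longrightarrow>
            computes_in_time P p G
              (\<lambda>M. critical_relaxed_stable_matching G M \<and>
                   (\<forall>M'. max_critical_relaxed_stable_matching G M' \<longrightarrow>
                      real (card M) \<ge> 2 / 3 * real (card M')))"
    by blast
qed

end
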